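(* Let $n\ge1$, let $p\in\mathbb Z^n$ be a primitive vector, $\Psi(z)=\min(0,p\cdot z)$ for $z\in\mathbb Z^n$, let $\psi$ be the canonical husking of $\Psi$, let $q\in\mathbb Z^n$ satisfy $p\cdot q=1$, and let $\phi=2n-1+\Delta\psi$ (a stable sandpile state). Then for every $z_0\in\mathbb Z^n$ far from $D(\psi)$ (i.e. there is $R>0$ such that for every $z_0\in\mathbb Z^n$ at Euclidean distance greater than $R$ from $D(\psi)$) and all $z\in\mathbb Z^n$, $$(W^{z_0}\phi)(z)=2n-1+\Delta\psi(z\pm q)=\phi(z\pm q),$$ where the sign is "$+$" if $\psi(z_0)<0$ and "$-$" if $\psi(z_0)=0$.
   Context: A vector $p\in\mathbb Z^n\setminus\{0\}$ is primitive if there are no integer $k>1$ and $p'\in\mathbb Z^n$ with $p=kp'$. For $z,z'\in\mathbb Z^n$, $z\sim z'$ means that their Euclidean distance is $1$. The discrete Laplacian is $\Delta F(z)=-2nF(z)+\sum_{z'\sim z}F(z')$; $F$ is superharmonic if $\Delta F\le0$ everywhere. $D(F)=\{z:\Delta F(z)\neq0\}$. $B_C(S)$ is the set of points of $\mathbb Z^n$ at Euclidean distance at most $C$ from $S$. For a superharmonic $F:\mathbb Z^n\to\mathbb Z$ and $k\in\mathbb Z_{\ge0}$, $$\Theta_k(F)=\{G:\mathbb Z^n\to\mathbb Z\mid\Delta G\le0,\ F-k\le G\le F,\ \exists C>0:\{F\ne G\}\subset B_C(D(F))\},$$ and $(F)_k(z)=\min\{G(z):G\in\Theta_k(F)\}$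 is the $k$-husking of $F$. For $\Psi=\min(0,p\cdot z)$ with $p$ primitive the sequence $(\Psi)_k$ is eventually constant in $k$ and its eventual value is the pointwise minimal function in $\bigcup_k\Theta_k(\Psi)$; it is called the canonical husking of $\Psi$ and denoted $\psi$. It satisfies $-2n+1\le\Delta\psi\le0$. A sandpile state is a function $\phi:\mathbb Z^n\to\mathbb Z_{\ge0}$; it is stable if $\phi\le 2n-1$. A toppling at $z$ subtracts $2n$ grains from $z$ and adds one grain to each neighbour of $z$; it is legal if there are at least $2n$ grains at $z$. Relaxation means doing legal topplings while it is possible (possibly infinitely many in total); the result does not depend on the order. If $\phi(z)=\phi(z')=2n-1$ for some $z'\sim z$, sending a wave from $z$ means making one toppling at $z$ followed by the relaxation; the resulting state is denoted $W^z\phi$ (starting from a stable state each vertex topples at most once during a wave). *)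

theory Defs
  imports "HOL-Analysis.Analysis"
begin

text \<open>
  The lattice is the type \<^typ>\<open>int ^ 'n\<close>, of dimension \<^term>\<open>CARD('n)\<close>. The library has no metric
  on \<^typ>\<open>int\<close>, so distances are taken in \<^typ>\<open>real ^ 'n\<close>, whose \<^const>\<open>dist\<close> is Euclidean.
\<close>

definition edist :: "int ^ 'n \<Rightarrow> int ^ 'n \<Rightarrow> real" where
  "edist z z' = dist (\<chi> i. real_of_int (z $ i)) (\<chi> i. real_of_int (z' $ i))"

definition idot :: "int ^ 'n \<Rightarrow> int ^ 'n \<Rightarrow> int" where
  "idot p z = (\<Sum>i\<in>UNIV. p $ i * z $ i)"

definition primitive :: "int ^ 'n \<Rightarrow> bool" where
  "primitive p \<longleftrightarrow> p \<noteq> 0 \<and> \<not> (\<exists>k p'. k > 1 \<and> p = k *s p')"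

definition adjacent :: "int ^ 'n \<Rightarrow> int ^ 'n \<Rightarrow> bool" where
  "adjacent z z' \<longleftrightarrow> edist z z' = 1"

lemma finite_adjacent: "finite {z'. adjacent z z'}"
proof -
  let ?P = "PiE UNIV (\<lambda>i. {z $ i - 1 .. z $ i + 1})"
  have "{z'. adjacent z z'} \<subseteq> vec_lambda ` ?P"
  proof
    fix z' assume "z' \<in> {z'. adjacent z z'}"
    then have d: "edist z z' = 1" by (simp add: adjacent_def)
    have "\<bar>real_of_int (z $ i) - real_of_int (z' $ i)\<bar> \<le> 1" for i
      using dist_vec_nth_le[of "\<chi> i. real_of_int (z $ i)" i "\<chi> i. real_of_int (z' $ i)"] d
      by (simp add: edist_def dist_real_def)
    then have "\<bar>z $ i - z' $ i\<bar> \<le> 1" for i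
      by (metis of_int_le_1_iff of_int_abs of_int_diff)
    then have "z $ i - 1 \<le> z' $ i \<and> z' $ i \<le> z $ i + 1" for i
      by (smt (verit))
    then have "vec_nth z' \<in> ?P" by auto
    moreover have "z' = vec_lambda (vec_nth z')" by simp
    ultimately show "z' \<in> vec_lambda ` ?P" by blast
  qed
  moreover have "finite ?P" by (rule finite_PiE) auto
  ultimately show ?thesis by (meson finite_imageI finite_subset)
qed

definition laplacian :: "(int ^ 'n \<Rightarrow> int) \<Rightarrow> int ^ 'n \<Rightarrow> int" where
  "laplacian F z = - 2 * int CARD('n) * F z + (\<Sum>z' | adjacent z z'. F z')"

definition superharmonic :: "(int ^ 'n \<Rightarrow> int) \<Rightarrow> bool" where
  "superharmonic F \<longleftrightarrow> (\<forall>z. laplacian F z \<le> 0)"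

definition defect :: "(int ^ 'n \<Rightarrow> int) \<Rightarrow> (int ^ 'n) set" where
  "defect F = {z. laplacian F z \<noteq> 0}"

text \<open>
  Subsets of the lattice are closed and discrete, so the distance to a nonempty set is attained;
  the neighbourhood of the empty set is empty.
\<close>

definition nbhd :: "real \<Rightarrow> (int ^ 'n) set \<Rightarrow> (int ^ 'n) set" where
  "nbhd C S = {z. \<exists>s\<in>S. edist z s \<le> C}"

definition Theta :: "nat \<Rightarrow> (int ^ 'n \<Rightarrow> int) \<Rightarrow> (int ^ 'n \<Rightarrow> int) set" where
  "Theta k F = {G. superharmonic G \<and> (\<forall>z. F z - int k \<le> G z \<and> G z \<le> F z) \<and>
                   (\<exists>C>0. {z. F z \<noteq> G z} \<subseteq> nbhd C (defect F))}"

lemma finite_Theta_values: "finite ((\<lambda>G. G z) ` Theta k F)"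
  by (rule finite_subset[of _ "{F z - int k .. F z}"]) (auto simp: Theta_def)

definition husking :: "nat \<Rightarrow> (int ^ 'n \<Rightarrow> int) \<Rightarrow> int ^ 'n \<Rightarrow> int" where
  "husking k F z = Min ((\<lambda>G. G z) ` Theta k F)"

text \<open>
  The eventual value of the sequence of huskings as functions: the index from which the sequence is
  constant does not depend on the point. Unspecified if the sequence does not stabilise.
\<close>

definition canonical_husking :: "(int ^ 'n \<Rightarrow> int) \<Rightarrow> int ^ 'n \<Rightarrow> int" where
  "canonical_husking F = (THE G. \<forall>\<^sub>F k in sequentially. husking k F = G)"

text \<open>
  States are integer-valued, since the toppling that starts a wave leaves a vertex with \<open>- 1\<close> grains.
\<close>

definition stable :: "(int ^ 'n \<Rightarrow> int) \<Rightarrow> bool" where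
  "stable \<phi> \<longleftrightarrow> (\<forall>z. \<phi> z \<le> 2 * int CARD('n) - 1)"

definition topple :: "int ^ 'n \<Rightarrow> (int ^ 'n \<Rightarrow> int) \<Rightarrow> int ^ 'n \<Rightarrow> int" where
  "topple z \<phi> = (\<lambda>x. if x = z then \<phi> x - 2 * int CARD('n)
                      else if adjacent z x then \<phi> x + 1 else \<phi> x)"

definition legal :: "int ^ 'n \<Rightarrow> (int ^ 'n \<Rightarrow> int) \<Rightarrow> bool" where
  "legal z \<phi> \<longleftrightarrow> 2 * int CARD('n) \<le> \<phi> z"

text \<open>
  A finite or infinite sequence of legal topplings, with idle steps allowed so that finite sequences
  are included. Pointwise eventual constancy means that every vertex topples only finitely often;
  stability of the limit means that no legal toppling is postponed forever.
\<close>

definition relaxes_to :: "(int ^ 'n \<Rightarrow> int) \<Rightarrow> (int ^ 'n \<Rightarrow> int) \<Rightarrow> bool" where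
  "relaxes_to \<phi> \<phi>' \<longleftrightarrow>
     (\<exists>X :: nat \<Rightarrow> int ^ 'n \<Rightarrow> int.
        X 0 = \<phi> \<and>
        (\<forall>i. X (Suc i) = X i \<or> (\<exists>z. legal z (X i) \<and> X (Suc i) = topple z (X i))) \<and>
        (\<forall>x. \<forall>\<^sub>F i in sequentially. X i x = \<phi>' x)) \<and>
     stable \<phi>'"

definition relaxation :: "(int ^ 'n \<Rightarrow> int) \<Rightarrow> int ^ 'n \<Rightarrow> int" where
  "relaxation \<phi> = (THE \<phi>'. relaxes_to \<phi> \<phi>')"

definition wave :: "int ^ 'n \<Rightarrow> (int ^ 'n \<Rightarrow> int) \<Rightarrow> int ^ 'n \<Rightarrow> int" where
  "wave z \<phi> =
     (if \<phi> z = 2 * int CARD('n) - 1 \<and> (\<exists>z'. adjacent z z' \<and> \<phi> z' = 2 * int CARD('n) - 1)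
      then relaxation (topple z \<phi>) else undefined)"

end

theory Submission
  imports Defs
begin

text \<open>
  Invariance under the translations orthogonal to \<open>p\<close> turns every husking into \<open>f (p \<cdot> z)\<close> for
  some \<open>f\<close> on the integers, and minimality forces the increments \<open>f (t + 1) - f t\<close> to be \<open>0\<close> or \<open>1\<close>.
  On a long interval without defects such an increment is harmonic, hence constant, and then \<open>f\<close>
  is \<open>0\<close> to the right of the interval or the identity to its left. The total defect equals the squared
  length of \<open>p\<close>, so only boundedly many intervals of fixed length meet it; hence \<open>f\<close> differs from
  \<open>min 0\<close> on a set bounded independently of \<open>k\<close>, and the huskings stabilise.

  By the least action principle the number of topplings in a wave is the least \<open>K\<close> with \<open>K z\<^sub>0 \<ge> 1\<close>
  for which \<open>\<psi> + K\<close> is superharmonic. It is at most \<open>\<psi> (z + q) - \<psi> z\<close>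
  (or \<open>\<psi> (z - q) - \<psi> z + 1\<close>). By the minimum principle it equals \<open>1\<close> far out on the side of \<open>z\<^sub>0\<close>,
  so that \<open>\<psi> + K\<close>, translated back, competes with the minimal function \<open>\<psi>\<close>; this gives equality.
\<close>

subsection \<open>The lattice\<close>

abbreviation unit_vec :: "'n \<Rightarrow> int ^ 'n" where
  "unit_vec i \<equiv> axis i 1"

section \<open>Euclidean distance and adjacency\<close>

lemma edist_eq_norm: "edist z z' = norm (\<chi> i. real_of_int (z $ i - z' $ i))"
proof -
  have "(\<chi> i. real_of_int (z $ i)) - (\<chi> i. real_of_int (z' $ i)) = (\<chi> i. real_of_int (z $ i - z' $ i))"
    by (simp add: vec_eq_iff)
  then show ?thesis
    by (simp add: edist_def dist_norm)
qed

lemma edist_minus_scale: "edist z (z - m *s q) = \<bar>real_of_int m\<bar> * norm (\<chi> i. real_of_int (q $ i))"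
proof -
  have "(\<chi> i. real_of_int (z $ i - (z - m *s q) $ i)) = real_of_int m *\<^sub>R (\<chi> i. real_of_int (q $ i))"
    by (simp add: vec_eq_iff)
  then show ?thesis
    by (simp add: edist_eq_norm)
qed

lemma abs_diff_nth_le_edist: "\<bar>real_of_int (z $ i - z' $ i)\<bar> \<le> edist z z'"
  using component_le_norm_cart[of "\<chi> i. real_of_int (z $ i - z' $ i)" i]
  by (simp add: edist_eq_norm)

text \<open>The squared distance is a sum of squares of integers; it equals 1 only if a single
  coordinate differs, and by one.\<close>

lemma adjacent_iff: "adjacent z z' \<longleftrightarrow> (\<exists>i. z' = z + unit_vec i \<or> z' = z - unit_vec i)"
proof
  assume "\<exists>i. z' = z + unit_vec i \<or> z' = z - unit_vec i"
  then obtain i s where s: "s = 1 \<or> s = -1" "z' = z - s *s unit_vec i"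
    by (metis diff_minus_eq_add vector_smult_lneg vector_smult_lid)
  have "(\<chi> j. real_of_int (unit_vec i $ j)) = axis i 1"
    by (simp add: vec_eq_iff axis_def)
  then show "adjacent z z'"
    using s by (auto simp: adjacent_def edist_minus_scale simp del: vector_smult_lneg vector_smult_lid)
next
  assume "adjacent z z'"
  then have "(\<Sum>i\<in>UNIV. (real_of_int (z $ i - z' $ i))\<^sup>2) = 1"
    by (simp add: adjacent_def edist_eq_norm norm_vec_def L2_set_def)
  then have "real_of_int (\<Sum>i\<in>UNIV. (z' $ i - z $ i)\<^sup>2) = 1"
    by (simp add: power2_commute)
  then have sum1: "(\<Sum>i\<in>UNIV. (z' $ i - z $ i)\<^sup>2) = 1"
    by linarith
  then obtain i where i: "z' $ i - z $ i \<noteq> 0"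
    by (metis (no_types, lifting) power_zero_numeral sum.neutral zero_neq_one)
  have split: "(z' $ i - z $ i)\<^sup>2 + (\<Sum>j\<in>UNIV - {i}. (z' $ j - z $ j)\<^sup>2) = 1"
    using sum1 by (simp add: sum.remove[of UNIV i])
  have "(z' $ i - z $ i)\<^sup>2 \<ge> 1"
    using i by (metis int_one_le_iff_zero_less zero_less_power2)
  moreover have "(\<Sum>j\<in>UNIV - {i}. (z' $ j - z $ j)\<^sup>2) \<ge> 0"
    by (simp add: sum_nonneg)
  ultimately have sq: "(z' $ i - z $ i)\<^sup>2 = 1" and rest: "(\<Sum>j\<in>UNIV - {i}. (z' $ j - z $ j)\<^sup>2) = 0"
    using split by auto
  from rest have "z' $ j = z $ j" if "j \<noteq> i" for j
    using that by (subst (asm) sum_nonneg_eq_0_iff) auto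
  moreover from sq have "z' $ i - z $ i = 1 \<or> z' $ i - z $ i = -1"
    by (simp add: power2_eq_1_iff)
  ultimately show "\<exists>i. z' = z + unit_vec i \<or> z' = z - unit_vec i"
    by (intro exI[of _ i]) (auto simp: vec_eq_iff axis_def algebra_simps)
qed

lemma adjacent_commute: "adjacent z z' \<longleftrightarrow> adjacent z' z"
  by (simp add: adjacent_def edist_def dist_commute)

lemma not_adjacent_self [simp]: "\<not> adjacent z z"
  by (simp add: adjacent_def edist_def)

lemma unit_vec_eq_iff [simp]: "unit_vec i = unit_vec j \<longleftrightarrow> i = j"
  by (metis axis_eq_axis one_neq_zero)

lemma sum_adjacent: "(\<Sum>z' | adjacent z z'. F z') = (\<Sum>i\<in>UNIV. F (z + unit_vec i) + F (z - unit_vec i))"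
proof -
  have "{z'. adjacent z z'} = range (\<lambda>i. z + unit_vec i) \<union> range (\<lambda>i. z - unit_vec i)"
    by (auto simp: adjacent_iff)
  moreover have "range (\<lambda>i. z + unit_vec i) \<inter> range (\<lambda>i. z - unit_vec i) = {}"
  proof -
    have "z + unit_vec i \<noteq> z - unit_vec j" for i j
    proof
      assume "z + unit_vec i = z - unit_vec j"
      then have "(z + unit_vec i) $ i = (z - unit_vec j) $ i"
        by simp
      then show False
        by (simp add: axis_def split: if_splits)
    qed
    then show ?thesis by auto
  qed
  ultimately have "(\<Sum>z' | adjacent z z'. F z')
      = sum F (range (\<lambda>i. z + unit_vec i)) + sum F (range (\<lambda>i. z - unit_vec i))"
    by (simp add: sum.union_disjoint)
  also have "\<dots> = (\<Sum>i\<in>UNIV. F (z + unit_vec i)) + (\<Sum>i\<in>UNIV. F (z - unit_vec i))"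
    by (simp add: sum.reindex inj_on_def)
  finally show ?thesis
    by (simp add: sum.distrib)
qed

section \<open>Calculus of the Laplacian and the local maximum principle\<close>

lemma laplacian_eq:
  fixes z :: "int ^ 'n"
  shows "laplacian F z = (\<Sum>i\<in>UNIV. F (z + unit_vec i) + F (z - unit_vec i) - 2 * F z)"
  by (simp add: laplacian_def sum_adjacent sum_subtractf sum.distrib)

lemma laplacian_add: "laplacian (\<lambda>z. F z + G z) z = laplacian F z + laplacian G z"
  by (simp add: laplacian_def sum.distrib algebra_simps)

lemma laplacian_diff: "laplacian (\<lambda>z. F z - G z) z = laplacian F z - laplacian G z"
  by (simp add: laplacian_def sum_subtractf algebra_simps)

lemma laplacian_const [simp]: "laplacian (\<lambda>z. c) z = 0"
  by (simp add: laplacian_eq)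

lemma laplacian_shift: "laplacian (\<lambda>z. F (z + v)) z = laplacian F (z + v)"
  by (simp add: laplacian_eq algebra_simps)

text \<open>Only the neighbour terms can differ where the two functions touch. This yields
  superharmonicity of minima and the least action principle.\<close>

lemma laplacian_mono_touching:
  assumes "F z = G z" "\<And>z'. adjacent z z' \<Longrightarrow> F z' \<le> G z'"
  shows "laplacian F z \<le> laplacian G z"
  using sum_mono[of "{z'. adjacent z z'}" F G] assms by (simp add: laplacian_def)

lemma superharmonic_min:
  assumes "superharmonic F" "superharmonic G"
  shows "superharmonic (\<lambda>z. min (F z) (G z))"
  unfolding superharmonic_def
proof
  fix z
  show "laplacian (\<lambda>z. min (F z) (G z)) z \<le> 0"
  proof (cases "F z \<le> G z")
    case True
    then have "laplacian (\<lambda>z. min (F z) (G z)) z \<le> laplacian F z"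
      by (intro laplacian_mono_touching) auto
    then show ?thesis using assms by (meson order_trans superharmonic_def)
  next
    case False
    then have "laplacian (\<lambda>z. min (F z) (G z)) z \<le> laplacian G z"
      by (intro laplacian_mono_touching) auto
    then show ?thesis using assms by (meson order_trans superharmonic_def)
  qed
qed

text \<open>The nonnegative differences \<open>F z - F z'\<close> sum to
  \<open>- laplacian F z\<close>, which is at most 0, so each of them vanishes.\<close>

lemma neighbours_eq_of_max:
  assumes "laplacian F z \<ge> 0" "\<And>z'. adjacent z z' \<Longrightarrow> F z' \<le> F z" "adjacent z z'"
  shows "F z' = F z"
proof -
  let ?N = "{z'. adjacent z z'}"
  \<comment> \<open>Summing the constant 1 counts the neighbours.\<close>
  have card: "int (card ?N) = 2 * int CARD('a)"
    using sum_adjacent[where z = z and F = "\<lambda>_. 1 :: int"] by simp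
  have "(\<Sum>z'\<in>?N. F z - F z') = - laplacian F z"
    by (simp add: laplacian_def sum_subtractf card)
  moreover have "(\<Sum>z'\<in>?N. F z - F z') \<ge> 0"
    using assms by (intro sum_nonneg) auto
  ultimately have "(\<Sum>z'\<in>?N. F z - F z') = 0"
    using assms(1) by linarith
  then show ?thesis
    using assms finite_adjacent[of z] by (subst (asm) sum_nonneg_eq_0_iff) auto
qed

lemma neighbours_eq_of_min:
  assumes "laplacian F z \<le> 0" "\<And>z'. adjacent z z' \<Longrightarrow> F z \<le> F z'" "adjacent z z'"
  shows "F z' = F z"
proof -
  have "laplacian (\<lambda>z. 0 - F z) z = - laplacian F z"
    by (simp only: laplacian_diff laplacian_const)
  then show ?thesis
    using neighbours_eq_of_max[of "\<lambda>z. 0 - F z" z z'] assms by auto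
qed

section \<open>The linear form \<open>idot p\<close> and lattice paths\<close>

lemma idot_add: "idot p (z + z') = idot p z + idot p z'"
  by (simp add: idot_def sum.distrib algebra_simps)

lemma idot_diff: "idot p (z - z') = idot p z - idot p z'"
  by (simp add: idot_def sum_subtractf algebra_simps)

lemma idot_scale: "idot p (m *s z) = m * idot p z"
  by (simp add: idot_def sum_distrib_left algebra_simps)

lemma idot_unit_vec [simp]: "idot p (unit_vec i) = p $ i"
  by (simp add: idot_def axis_def if_distrib[of "\<lambda>x. _ * x"] cong: if_cong)

lemma idot_minus_left [simp]: "idot (- p) z = - idot p z"
  by (simp add: idot_def sum_negf)

definition norm1 :: "int ^ 'n \<Rightarrow> int" where
  "norm1 p = (\<Sum>i\<in>UNIV. \<bar>p $ i\<bar>)"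

lemma abs_nth_le_norm1: "\<bar>p $ i\<bar> \<le> norm1 p"
  unfolding norm1_def by (rule member_le_sum) auto

lemma norm1_nonneg: "0 \<le> norm1 p"
  by (simp add: norm1_def sum_nonneg)

lemma norm1_minus [simp]: "norm1 (- p) = norm1 p"
  by (simp add: norm1_def)

text \<open>Decreasing measure for inductions along lattice paths.\<close>

lemma norm1_step:
  assumes "w $ i \<noteq> 0"
  shows "norm1 (w - sgn (w $ i) *s unit_vec i) = norm1 w - 1"
proof -
  have "norm1 (w - sgn (w $ i) *s unit_vec i) = (\<Sum>j\<in>UNIV. \<bar>w $ j\<bar> - (if j = i then 1 else 0))"
    unfolding norm1_def using assms
    by (intro sum.cong) (auto simp: axis_def sgn_if)
  then show ?thesis by (simp add: sum_subtractf norm1_def)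
qed

lemma norm1_eq_0_iff [simp]: "norm1 w = 0 \<longleftrightarrow> w = 0"
  by (simp add: norm1_def sum_nonneg_eq_0_iff vec_eq_iff)

lemma norm1_zero [simp]: "norm1 0 = 0"
  by simp

lemma adjacent_step: "s = 1 \<or> s = -1 \<Longrightarrow> adjacent z (z + s *s unit_vec i)"
  by (auto simp: adjacent_iff vector_sneg_minus1[symmetric])

lemma adjacent_sgn_step: "(w :: int ^ 'n) $ i \<noteq> 0 \<Longrightarrow> adjacent z (z + sgn (w $ i) *s unit_vec i)"
  by (rule adjacent_step) (auto simp: sgn_if)

lemma adjacent_idot_le: "adjacent z z' \<Longrightarrow> \<bar>idot p z' - idot p z\<bar> \<le> norm1 p"
  using abs_nth_le_norm1[of p] by (auto simp: adjacent_iff idot_add idot_diff)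

text \<open>Taking first the unit steps that do not increase \<open>idot p\<close> keeps a lattice path in the half-space.\<close>

lemma halfspace_connected:
  assumes step: "\<And>z z'. idot p z < c \<Longrightarrow> idot p z' < c \<Longrightarrow> adjacent z z' \<Longrightarrow> z \<in> A \<Longrightarrow> z' \<in> A"
    and "z \<in> A" "idot p z < c" "idot p z' < c"
  shows "z' \<in> A"
  using assms(2-)
proof (induction "nat (norm1 (z' - z))" arbitrary: z z')
  case 0
  then have "z' - z = 0"
    using norm1_nonneg[of "z' - z"] by (metis norm1_eq_0_iff order_antisym nat_0_iff)
  then show ?case using 0 by simp
next
  case (Suc m)
  define w where "w = z' - z"
  have norm_w: "norm1 w = int m + 1"
    using Suc.hyps(2) norm1_nonneg[of w] by (simp add: w_def)
  show ?case
  proof (cases "\<exists>i. w $ i \<noteq> 0 \<and> p $ i * sgn (w $ i) \<le> 0")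
    case True
    then obtain i where i: "w $ i \<noteq> 0" "p $ i * sgn (w $ i) \<le> 0" by auto
    define y where "y = z + sgn (w $ i) *s unit_vec i"
    have y: "idot p y < c"
      using i Suc.prems by (simp add: y_def idot_add idot_scale mult.commute)
    have "y \<in> A"
      using step[OF Suc.prems(2) y] adjacent_sgn_step[OF i(1)] Suc.prems by (simp add: y_def)
    moreover have "z' - y = w - sgn (w $ i) *s unit_vec i"
      by (simp add: w_def y_def)
    then have "m = nat (norm1 (z' - y))"
      using norm1_step[OF i(1)] norm_w by simp
    ultimately show ?thesis
      using Suc.hyps(1) y Suc.prems by blast
  next
    \<comment> \<open>Every remaining step raises \<open>idot p\<close>, so the path is shortened at
      its end: the predecessor \<open>y\<close> of \<open>z'\<close> lies even lower than
      \<open>z'\<close>.\<close>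
    case False
    have "w \<noteq> 0" using norm_w by auto
    then obtain i where i: "w $ i \<noteq> 0" by (metis vec_eq_iff zero_index)
    with False have pos: "p $ i * sgn (w $ i) > 0" by force
    define y where "y = z' - sgn (w $ i) *s unit_vec i"
    have y: "idot p y < c"
      using pos Suc.prems by (simp add: y_def idot_diff idot_scale mult.commute)
    have "y - z = w - sgn (w $ i) *s unit_vec i"
      by (simp add: w_def y_def)
    then have "m = nat (norm1 (y - z))"
      using norm1_step[OF i(1)] norm_w by simp
    then have "y \<in> A"
      using Suc.hyps(1) y Suc.prems by blast
    moreover have "adjacent y z'"
      using adjacent_sgn_step[OF i, of y] by (simp add: y_def)
    ultimately show ?thesis
      using step y Suc.prems by blast
  qed
qed

subsection \<open>Functions of \<open>idot p\<close>\<close>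

definition line_laplacian :: "int ^ 'n \<Rightarrow> (int \<Rightarrow> int) \<Rightarrow> int \<Rightarrow> int" where
  "line_laplacian p f t = (\<Sum>i\<in>UNIV. f (t + p $ i) + f (t - p $ i) - 2 * f t)"

lemma laplacian_comp_idot: "laplacian (\<lambda>z. f (idot p z)) z = line_laplacian p f (idot p z)"
  by (simp add: laplacian_eq line_laplacian_def idot_add idot_diff)

lemma line_laplacian_eq_0:
  assumes "\<And>s. \<bar>s - t\<bar> \<le> norm1 p \<Longrightarrow> f s = a * s + b"
  shows "line_laplacian p f t = 0"
proof -
  have "f (t + p $ i) + f (t - p $ i) - 2 * f t = 0" for i
    using abs_nth_le_norm1[of p i] norm1_nonneg[of p] by (simp add: assms algebra_simps)
  then show ?thesis by (simp add: line_laplacian_def)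
qed

locale slope_01 =
  fixes p :: "int ^ 'n" and f :: "int \<Rightarrow> int" and T :: int
  assumes incr: "f t \<le> f (t + 1)" "f (t + 1) \<le> f t + 1"
    and super: "line_laplacian p f t \<le> 0"
    and far: "T < \<bar>t\<bar> \<Longrightarrow> f t = min 0 t"
begin

lemma mono: "s \<le> t \<Longrightarrow> f s \<le> f t"
  by (induction t rule: int_ge_induct) (auto intro: order_trans incr)

lemma lipschitz: "s \<le> t \<Longrightarrow> f t - f s \<le> t - s"
proof (induction t rule: int_ge_induct)
  case (step t)
  then show ?case using incr(2)[of t] by linarith
qed simp

lemma le_min: "f t \<le> min 0 t"
proof -
  have "f t \<le> f (\<bar>T\<bar> + \<bar>t\<bar> + 1)" by (rule mono) simp
  moreover have "f t - f (- \<bar>T\<bar> - \<bar>t\<bar> - 1) \<le> t - (- \<bar>T\<bar> - \<bar>t\<bar> - 1)" by (rule lipschitz) simp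
  ultimately show ?thesis by (simp add: far)
qed

text \<open>The reflection fixes \<open>min 0\<close> and exchanges the slopes 0 and 1, so results
  about the right half carry over to the left half.\<close>

lemma reflect: "slope_01 p (\<lambda>t. f (- t) + t) T"
proof
  fix t
  show "f (- t) + t \<le> f (- (t + 1)) + (t + 1)" "f (- (t + 1)) + (t + 1) \<le> f (- t) + t + 1"
    using incr[of "- t - 1"] by auto
  have "line_laplacian p (\<lambda>t. f (- t) + t) t = line_laplacian p f (- t)"
    unfolding line_laplacian_def by (intro sum.cong) (simp_all add: algebra_simps)
  then show "line_laplacian p (\<lambda>t. f (- t) + t) t \<le> 0"
    using super by simp
  show "T < \<bar>t\<bar> \<Longrightarrow> f (- t) + t = min 0 t"
    using far[of "- t"] by auto
qed

text \<open>A minimum principle spreads flatness to the right: where \<open>f s = f c\<close> and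
  all points \<open>s + p $ i\<close>, \<open>s - p $ i\<close> lie right of \<open>c\<close>,
  superharmonicity forces equality at each of them. Far out the constant must be 0.\<close>

lemma zero_right_of_flat:
  assumes p: "p \<noteq> 0"
    and flat: "\<And>t. c \<le> t \<Longrightarrow> t \<le> c + 2 * norm1 p \<Longrightarrow> f t = f c"
    and "c \<le> t"
  shows "f t = 0"
proof -
  have const: "f t = f c" if "c \<le> t" for t
    using that
  proof (induction "nat (t - c)" arbitrary: t rule: less_induct)
    case less
    show ?case
    proof (cases "t \<le> c + 2 * norm1 p")
      case True
      then show ?thesis using flat less.prems by blast
    next
      case False
      obtain j where j: "p $ j \<noteq> 0" using p by (metis vec_eq_iff zero_index)
      \<comment> \<open>The point \<open>t\<close> is one of the neighbours of \<open>s\<close>, and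
        for \<open>t\<close> beyond the flat window all neighbours of \<open>s\<close> still lie
        right of \<open>c\<close>.\<close>
      define s where "s = t - \<bar>p $ j\<bar>"
      have "\<bar>p $ j\<bar> \<le> norm1 p" by (rule abs_nth_le_norm1)
      then have s: "c + norm1 p \<le> s" "s < t" using False j by (auto simp: s_def)
      have fs: "f s = f c"
        using less.hyps[of s] s norm1_nonneg[of p] by auto
      have ge: "f c \<le> f (s + p $ i)" "f c \<le> f (s - p $ i)" for i
        using s abs_nth_le_norm1[of p i] by (auto intro!: mono)
      have "(\<Sum>i\<in>UNIV. f (s + p $ i) + f (s - p $ i) - 2 * f s) \<le> 0"
        using super[of s] by (simp add: line_laplacian_def)
      moreover have "f (s + p $ j) + f (s - p $ j) - 2 * f s
          \<le> (\<Sum>i\<in>UNIV. f (s + p $ i) + f (s - p $ i) - 2 * f s)"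
      proof (rule member_le_sum)
        fix i show "0 \<le> f (s + p $ i) + f (s - p $ i) - 2 * f s"
          using ge[of i] fs by linarith
      qed auto
      ultimately have "f (s + p $ j) \<le> f c" "f (s - p $ j) \<le> f c"
        using ge[of j] fs by linarith+
      moreover have "t = s + p $ j \<or> t = s - p $ j" by (auto simp: s_def)
      ultimately have "f t \<le> f c" by auto
      then show ?thesis using mono[OF less.prems] by simp
    qed
  qed
  have "f c = f (\<bar>T\<bar> + \<bar>c\<bar> + 1)" by (rule const[symmetric]) simp
  then show ?thesis using const[OF \<open>c \<le> t\<close>] by (simp add: far)
qed

text \<open>Where it is harmonic, an increment with values in \<open>{0, 1}\<close> equals its mean over the neighbours,
  hence agrees with all of them.\<close>

lemma increment_step:
  assumes "line_laplacian p f t = 0" "line_laplacian p f (t + 1) = 0" "s = 1 \<or> s = -1"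
  shows "f (t + s * p $ i + 1) - f (t + s * p $ i) = f (t + 1) - f t"
proof -
  define u where "u s = f (s + 1) - f s" for s
  have u01: "u s = 0 \<or> u s = 1" for s using incr[of s] by (auto simp: u_def)
  have "line_laplacian p u t = line_laplacian p f (t + 1) - line_laplacian p f t"
    unfolding line_laplacian_def sum_subtractf[symmetric]
    by (intro sum.cong) (auto simp: u_def algebra_simps)
  then have sum0: "(\<Sum>i\<in>UNIV. u (t + p $ i) + u (t - p $ i) - 2 * u t) = 0"
    using assms by (simp add: line_laplacian_def)
  have "u (t + p $ i) + u (t - p $ i) - 2 * u t = 0"
  proof (cases "u t = 0")
    case True
    have "\<forall>i\<in>UNIV. u (t + p $ i) + u (t - p $ i) - 2 * u t = 0"
    proof (subst sum_nonneg_eq_0_iff[symmetric])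
      fix i show "0 \<le> u (t + p $ i) + u (t - p $ i) - 2 * u t"
        using True u01[of "t + p $ i"] u01[of "t - p $ i"] by linarith
    qed (use sum0 in auto)
    then show ?thesis by simp
  next
    case False
    have "\<forall>i\<in>UNIV. 2 * u t - (u (t + p $ i) + u (t - p $ i)) = 0"
    proof (subst sum_nonneg_eq_0_iff[symmetric])
      fix i show "0 \<le> 2 * u t - (u (t + p $ i) + u (t - p $ i))"
        using False u01[of t] u01[of "t + p $ i"] u01[of "t - p $ i"] by linarith
    qed (use sum0 in \<open>auto simp: sum_subtractf\<close>)
    then show ?thesis by simp
  qed
  then have "u (t + p $ i) = u t \<and> u (t - p $ i) = u t"
    using u01[of t] u01[of "t + p $ i"] u01[of "t - p $ i"] by linarith
  then show ?thesis using assms(3) by (auto simp: u_def)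
qed

text \<open>The increment is carried along a lattice path from 0 to \<open>w\<close>. A path of
  \<open>norm1 w\<close> steps moves \<open>idot p\<close> by at most
  \<open>norm1 w * norm1 p\<close>, so it stays between \<open>a\<close> and \<open>b\<close>;
  harmonicity up to \<open>b + 1\<close> is required because an increment involves two consecutive
  points.\<close>

lemma increment_path:
  assumes harm: "\<And>t. a \<le> t \<Longrightarrow> t \<le> b + 1 \<Longrightarrow> line_laplacian p f t = 0"
    and "norm1 w * norm1 p \<le> t - a" "norm1 w * norm1 p \<le> b - t"
  shows "f (t + idot p w + 1) - f (t + idot p w) = f (t + 1) - f t"
  using assms(2,3)
proof (induction "nat (norm1 w)" arbitrary: w t)
  case 0
  then have "w = 0" using norm1_nonneg[of w] by (metis norm1_eq_0_iff order_antisym nat_0_iff)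
  then show ?case by (simp add: idot_def)
next
  case (Suc m)
  from Suc.hyps(2) have "w \<noteq> 0" by auto
  then obtain i where i: "w $ i \<noteq> 0" by (metis vec_eq_iff zero_index)
  define s where "s = sgn (w $ i)"
  have s: "s = 1 \<or> s = -1" using i by (auto simp: s_def sgn_if)
  define v where "v = w - s *s unit_vec i"
  have v: "norm1 v = norm1 w - 1" unfolding v_def s_def by (rule norm1_step[OF i])
  have dot: "idot p w = s * p $ i + idot p v"
    by (simp add: v_def idot_diff idot_scale)
  have "1 \<le> norm1 w" using Suc.hyps(2) by linarith
  then have "norm1 p \<le> norm1 w * norm1 p"
    using norm1_nonneg[of p] mult_right_mono[of 1 "norm1 w" "norm1 p"] by simp
  then have t: "a \<le> t" "t \<le> b" using Suc.prems norm1_nonneg[of p] by linarith+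
  have "\<bar>s * p $ i\<bar> \<le> norm1 p" using s abs_nth_le_norm1[of p i] by auto
  then have "norm1 v * norm1 p \<le> t + s * p $ i - a" "norm1 v * norm1 p \<le> b - (t + s * p $ i)"
    using Suc.prems unfolding v by (auto simp: left_diff_distrib)
  then have "f (t + s * p $ i + idot p v + 1) - f (t + s * p $ i + idot p v)
      = f (t + s * p $ i + 1) - f (t + s * p $ i)"
    using Suc.hyps v by (intro Suc.hyps(1)) auto
  also have "\<dots> = f (t + 1) - f t"
    using harm t s by (intro increment_step) auto
  finally show ?case by (simp add: dot add.assoc)
qed

end

text \<open>A window of length \<open>2 * norm1 p\<close>, a margin \<open>norm1 q * norm1 p\<close>
  on either side for lattice paths from 0 to \<open>q\<close>, and one more point for the
  increment.\<close>

definition gap_length :: "int ^ 'n \<Rightarrow> int ^ 'n \<Rightarrow> int" where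
  "gap_length p q = 2 * norm1 q * norm1 p + 2 * norm1 p + 1"

lemma gap_length_pos: "0 < gap_length p q"
  using norm1_nonneg[of p] norm1_nonneg[of q] by (simp add: gap_length_def add_nonneg_pos)

section \<open>Harmonic gaps and the flux argument\<close>

context slope_01
begin

text \<open>Transport along \<open>q\<close> equates consecutive increments, so the slope is
  constant on a window. Slope 0 is the flat case; slope 1 becomes flat after reflection.\<close>

lemma harmonic_gap:
  assumes q: "idot p q = 1"
    and harm: "\<And>t. a \<le> t \<Longrightarrow> t \<le> a + gap_length p q \<Longrightarrow> line_laplacian p f t = 0"
  shows "(\<forall>t\<ge>a + gap_length p q. f t = 0) \<or> (\<forall>t\<le>a. f t = t)"
proof -
  define c where "c = a + norm1 q * norm1 p"
  have qp: "0 \<le> norm1 q * norm1 p" using norm1_nonneg[of p] norm1_nonneg[of q] by simp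
  have p: "p \<noteq> 0" using q by (auto simp: idot_def)
  have constant_incr: "f (t + 1 + 1) - f (t + 1) = f (t + 1) - f t" if "c \<le> t" "t \<le> c + 2 * norm1 p" for t
  proof -
    have "norm1 q * norm1 p \<le> t - a" "norm1 q * norm1 p \<le> a + gap_length p q - 1 - t"
      using that unfolding c_def gap_length_def by linarith+
    from increment_path[OF _ this] show ?thesis using harm q by simp
  qed
  define a' where "a' = f (c + 1) - f c"
  have slope: "f t = f c + a' * (t - c) \<and> f (t + 1) - f t = a'"
    if "c \<le> t" "t \<le> c + 2 * norm1 p" for t
    using that
  proof (induction t rule: int_ge_induct)
    case (step i)
    then have "f i = f c + a' * (i - c)" "f (i + 1) - f i = a'" "f (i + 1 + 1) - f (i + 1) = f (i + 1) - f i"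
      using constant_incr[of i] by auto
    moreover have "a' * (i + 1 - c) = a' * (i - c) + a'" by (simp add: algebra_simps)
    ultimately show ?case by linarith
  qed (simp add: a'_def)
  consider "a' = 0" | "a' = 1" using incr[of c] unfolding a'_def by linarith
  then show ?thesis
  proof cases
    case 1
    have "f t = f c" if "c \<le> t" "t \<le> c + 2 * norm1 p" for t
      using slope[OF that] 1 by simp
    then have "f t = 0" if "c \<le> t" for t
      by (rule zero_right_of_flat[OF p _ that])
    then show ?thesis using norm1_nonneg[of p] qp by (auto simp: c_def gap_length_def)
  next
    case 2
    \<comment> \<open>The right end of the window; its reflection \<open>- d\<close> is the left end
      of a flat window.\<close>
    define d where "d = c + 2 * norm1 p"
    interpret r: slope_01 p "\<lambda>t. f (- t) + t" T by (rule reflect)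
    have "f (- t) + t = f c - c" if "- d \<le> t" "t \<le> - d + 2 * norm1 p" for t
      using slope[of "- t"] 2 that by (simp add: d_def)
    then have "f (- t) + t = f (- (- d)) + - d" if "- d \<le> t" "t \<le> - d + 2 * norm1 p" for t
      using that norm1_nonneg[of p] by (metis add.commute le_add_same_cancel1 mult_nonneg_nonneg order_refl zero_le_numeral)
    then have "f (- t) + t = 0" if "- d \<le> t" for t
      by (rule r.zero_right_of_flat[OF p _ that])
    from this[of "- t" for t] have "f t = t" if "t \<le> d" for t using that by force
    then show ?thesis using norm1_nonneg[of p] qp by (auto simp: c_def d_def)
  qed
qed

text \<open>The flux through \<open>t\<close>: a discrete antiderivative of the Laplacian.\<close>

definition flux :: "int \<Rightarrow> int" where
  "flux t = (\<Sum>i\<in>UNIV. \<Sum>j<nat \<bar>p $ i\<bar>. f (t + \<bar>p $ i\<bar> - int j) - f (t - int j))"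

text \<open>Both inner sums telescope, leaving the first differences on the two sides of
  \<open>t\<close>. The sign of \<open>p $ i\<close> is immaterial because the second difference is
  symmetric.\<close>

lemma flux_diff: "flux t - flux (t - 1) = line_laplacian p f t"
proof -
  have tele: "(\<Sum>j<m. f (s - int j) - f (s - 1 - int j)) = f s - f (s - int m)" for m s
    by (induction m) (simp_all add: algebra_simps)
  have "(\<Sum>j<nat \<bar>p $ i\<bar>. f (t + \<bar>p $ i\<bar> - int j) - f (t - int j))
      - (\<Sum>j<nat \<bar>p $ i\<bar>. f (t - 1 + \<bar>p $ i\<bar> - int j) - f (t - 1 - int j))
      = f (t + p $ i) + f (t - p $ i) - 2 * f t" (is "?l = _") for i
  proof -
    have "?l = (\<Sum>j<nat \<bar>p $ i\<bar>. f (t + \<bar>p $ i\<bar> - int j) - f (t + \<bar>p $ i\<bar> - 1 - int j))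
        - (\<Sum>j<nat \<bar>p $ i\<bar>. f (t - int j) - f (t - 1 - int j))"
      unfolding sum_subtractf[symmetric] by (intro sum.cong) (auto simp: algebra_simps)
    also have "\<dots> = f (t + p $ i) + f (t - p $ i) - 2 * f t"
      by (subst tele, subst tele) (auto simp: abs_if)
    finally show ?thesis .
  qed
  then show ?thesis by (simp add: flux_def line_laplacian_def sum_subtractf[symmetric])
qed

text \<open>Each of the \<open>\<bar>p $ i\<bar>\<close> terms is a difference of \<open>f\<close>
  over the distance \<open>\<bar>p $ i\<bar>\<close>, hence lies between 0 and
  \<open>\<bar>p $ i\<bar>\<close>.\<close>

lemma flux_bounds: "0 \<le> flux t" "flux t \<le> (\<Sum>i\<in>UNIV. (p $ i)\<^sup>2)"
proof -
  show "0 \<le> flux t" unfolding flux_def by (intro sum_nonneg) (simp add: mono)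
  show "flux t \<le> (\<Sum>i\<in>UNIV. (p $ i)\<^sup>2)" unfolding flux_def
  proof (intro sum_mono)
    fix i
    have "f (t + \<bar>p $ i\<bar> - int j) - f (t - int j) \<le> \<bar>p $ i\<bar>" for j
      using lipschitz[of "t - int j" "t + \<bar>p $ i\<bar> - int j"] by simp
    then have "(\<Sum>j<nat \<bar>p $ i\<bar>. f (t + \<bar>p $ i\<bar> - int j) - f (t - int j)) \<le> (\<Sum>j<nat \<bar>p $ i\<bar>. \<bar>p $ i\<bar>)"
      by (intro sum_mono)
    then show "(\<Sum>j<nat \<bar>p $ i\<bar>. f (t + \<bar>p $ i\<bar> - int j) - f (t - int j)) \<le> (p $ i)\<^sup>2"
      by (simp add: power2_eq_square)
  qed
qed

lemma flux_antimono: "s \<le> t \<Longrightarrow> flux t \<le> flux s"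
proof (induction t rule: int_ge_induct)
  case (step t)
  then show ?case using flux_diff[of "t + 1"] super[of "t + 1"] by simp
qed simp

text \<open>Each interval that meets the defect costs at least one unit of flux.\<close>

lemma flux_less: "line_laplacian p f t \<noteq> 0 \<Longrightarrow> s < t \<Longrightarrow> t \<le> r \<Longrightarrow> flux r < flux s"
  using flux_antimono[of s "t - 1"] flux_antimono[of t r] flux_diff[of t] super[of t] by simp

end

text \<open>The number of integers in \<open>\<Sum>i (p $ i)^2 + 1\<close> consecutive windows of
  \<open>gap_length p q + 1\<close> integers, one window more than can meet the defect.\<close>

definition husk_width :: "int ^ 'n \<Rightarrow> int ^ 'n \<Rightarrow> int" where
  "husk_width p q = ((\<Sum>i\<in>UNIV. (p $ i)\<^sup>2) + 1) * (gap_length p q + 1)"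

lemma husk_width_nonneg: "0 \<le> husk_width p q"
proof -
  have "0 \<le> (\<Sum>i\<in>UNIV. (p $ i)\<^sup>2)" by (simp add: sum_nonneg)
  then show ?thesis using gap_length_pos[of p q] by (simp add: husk_width_def)
qed

context slope_01
begin

text \<open>Pigeonhole: the flux is too small for every window to contain a defect, so one of them
  is a harmonic gap.\<close>

lemma zero_right:
  assumes q: "idot p q = 1" and t: "husk_width p q \<le> t"
  shows "f t = 0"
proof -
  define S where "S = (\<Sum>i\<in>UNIV. (p $ i)\<^sup>2)"
  define L where "L = gap_length p q"
  have S: "0 \<le> S" by (simp add: S_def sum_nonneg)
  have L: "0 < L" by (simp add: L_def gap_length_pos)
  define start where "start j = int j * (L + 1)" for j
  have "\<exists>j\<le>nat S. \<forall>t. start j \<le> t \<longrightarrow> t \<le> start j + L \<longrightarrow> line_laplacian p f t = 0"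
  proof (rule ccontr)
    assume neg: "\<not> ?thesis"
    \<comment> \<open>For \<open>j = S + 1\<close> this bound is negative, against the nonnegativity
      of the flux.\<close>
    have "flux (start j - 1) \<le> S - int j" if "j \<le> Suc (nat S)" for j
      using that
    proof (induction j)
      case 0
      then show ?case using flux_bounds(2) by (simp add: S_def)
    next
      case (Suc j)
      with neg obtain t where "start j \<le> t" "t \<le> start j + L" "line_laplacian p f t \<noteq> 0"
        by auto
      then have "flux (start j + L) < flux (start j - 1)" by (intro flux_less) auto
      moreover have "start (Suc j) - 1 = start j + L" by (simp add: start_def algebra_simps)
      ultimately show ?case using Suc by simp
    qed
    from this[of "Suc (nat S)"] show False using flux_bounds(1)[of "start (Suc (nat S)) - 1"] S by simp
  qed
  then obtain j where j: "j \<le> nat S"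
    and gap: "\<And>t. start j \<le> t \<Longrightarrow> t \<le> start j + gap_length p q \<Longrightarrow> line_laplacian p f t = 0"
    by (auto simp: L_def)
  have "start j + (L + 1) \<le> husk_width p q"
  proof -
    have "(int j + 1) * (L + 1) \<le> (S + 1) * (L + 1)" using j L S by (intro mult_right_mono) auto
    then show ?thesis by (simp add: start_def husk_width_def S_def L_def algebra_simps)
  qed
  moreover have start: "0 \<le> start j" using L by (simp add: start_def)
  ultimately have "start j + L \<le> t" "0 \<le> t" using t L by auto
  from harmonic_gap[OF q gap] show ?thesis
  proof
    assume "\<forall>t\<ge>start j + gap_length p q. f t = 0"
    then show ?thesis using \<open>start j + L \<le> t\<close> by (simp add: L_def)
  next
    \<comment> \<open>The gap starts at or right of 0, so \<open>f 0 = 0\<close>, and monotonicity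
      together with \<open>le_min\<close> gives 0 from there on.\<close>
    assume "\<forall>t\<le>start j. f t = t"
    then have "f 0 = 0" using start by simp
    then show ?thesis using mono[OF \<open>0 \<le> t\<close>] le_min[of t] by simp
  qed
qed

lemma eq_min:
  assumes q: "idot p q = 1" and t: "husk_width p q \<le> \<bar>t\<bar>"
  shows "f t = min 0 t"
proof (cases "0 \<le> t")
  case True
  then show ?thesis using zero_right[OF q] t by simp
next
  case False
  interpret r: slope_01 p "\<lambda>t. f (- t) + t" T by (rule reflect)
  show ?thesis using r.zero_right[OF q, of "- t"] False t by simp
qed

text \<open>Inside the strip monotonicity compares with the value at its left end. This is the depth
  bound that makes the huskings stabilise.\<close>

lemma ge_min:
  assumes q: "idot p q = 1"
  shows "min 0 t - husk_width p q \<le> f t"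
proof (cases "husk_width p q \<le> \<bar>t\<bar>")
  case True
  then show ?thesis using eq_min[OF q True] husk_width_nonneg[of p q] by linarith
next
  case False
  then have "f (- husk_width p q) \<le> f t" by (intro mono) auto
  then show ?thesis using eq_min[OF q, of "- husk_width p q"] husk_width_nonneg[of p q] by simp
qed

end

subsection \<open>The husking of an edge\<close>

definition edge :: "int ^ 'n \<Rightarrow> int ^ 'n \<Rightarrow> int" where
  "edge p z = min 0 (idot p z)"

lemma laplacian_edge_eq_0:
  assumes "norm1 p \<le> \<bar>idot p z\<bar>"
  shows "laplacian (edge p) z = 0"
proof -
  have "laplacian (edge p) z = line_laplacian p (min 0) (idot p z)"
    unfolding edge_def[abs_def] by (rule laplacian_comp_idot[where f = "min 0"])
  also have "\<dots> = 0"
  proof (cases "0 \<le> idot p z")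
    case True
    then show ?thesis using assms by (intro line_laplacian_eq_0[where a = 0 and b = 0]) auto
  next
    case False
    then show ?thesis using assms by (intro line_laplacian_eq_0[where a = 1 and b = 0]) auto
  qed
  finally show ?thesis .
qed

lemma superharmonic_edge: "superharmonic (edge p)"
proof -
  have "superharmonic (\<lambda>z. min 0 (idot p z))"
  proof (intro superharmonic_min)
    show "superharmonic (\<lambda>z. 0)" by (simp add: superharmonic_def)
    show "superharmonic (idot p)"
      by (simp add: superharmonic_def laplacian_eq idot_add idot_diff)
  qed
  then show ?thesis by (simp add: edge_def[abs_def])
qed

lemma laplacian_edge_neq_0:
  assumes "p \<noteq> 0" "idot p z = 0"
  shows "laplacian (edge p) z \<noteq> 0"
proof -
  have "laplacian (edge p) z = (\<Sum>i\<in>UNIV. - \<bar>p $ i\<bar>)"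
    unfolding laplacian_eq using assms
    by (intro sum.cong) (auto simp: edge_def idot_add idot_diff min_def)
  also have "\<dots> = - norm1 p" by (simp add: norm1_def sum_negf)
  finally show ?thesis using assms by simp
qed

lemma abs_idot_diff_le: "\<bar>real_of_int (idot p z - idot p s)\<bar> \<le> real_of_int (norm1 p) * edist z s"
proof -
  have "\<bar>real_of_int (idot p z - idot p s)\<bar> = \<bar>\<Sum>i\<in>UNIV. real_of_int (p $ i) * real_of_int (z $ i - s $ i)\<bar>"
    unfolding idot_diff[symmetric] by (simp add: idot_def)
  also have "\<dots> \<le> (\<Sum>i\<in>UNIV. \<bar>real_of_int (p $ i) * real_of_int (z $ i - s $ i)\<bar>)"
    by (rule sum_abs)
  also have "\<dots> \<le> (\<Sum>i\<in>UNIV. \<bar>real_of_int (p $ i)\<bar> * edist z s)"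
    unfolding abs_mult by (intro sum_mono mult_left_mono abs_diff_nth_le_edist) simp
  also have "\<dots> = real_of_int (norm1 p) * edist z s"
    by (simp add: norm1_def sum_distrib_right)
  finally show ?thesis .
qed

text \<open>Each layer of thickness \<open>norm1 p\<close> lowers the upper bound for
  \<open>d\<close> by one: a value equal to the previous bound would be a local maximum and would
  spread along a ray into the region where \<open>d\<close> vanishes.\<close>

lemma subharmonic_vanishes:
  fixes d :: "int ^ 'n \<Rightarrow> int" and k :: nat
  assumes p: "p \<noteq> 0"
    and d: "\<And>z. 0 \<le> d z" "\<And>z. d z \<le> int k"
    and sub: "\<And>z. norm1 p \<le> idot p z \<Longrightarrow> 0 \<le> laplacian d z"
    and far: "\<And>z. T < idot p z \<Longrightarrow> d z = 0"
    and z: "(int k + 1) * norm1 p \<le> idot p z"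
  shows "d z = 0"
proof -
  have "d z \<le> int (k - m)" if "m \<le> k" "(int m + 1) * norm1 p \<le> idot p z" for m z
    using that
  proof (induction m arbitrary: z)
    case 0
    then show ?case using d by simp
  next
    case (Suc m)
    have near: "(int m + 1) * norm1 p \<le> idot p y'"
      if "(int (Suc m) + 1) * norm1 p \<le> idot p y" "adjacent y y'" for y y'
      using adjacent_idot_le[OF that(2), of p] that(1) by (simp add: algebra_simps)
    have bound: "d y' \<le> int (k - m)"
      if "(int (Suc m) + 1) * norm1 p \<le> idot p y" "adjacent y y'" for y y'
      using Suc.IH[OF _ near[OF that]] Suc.prems by simp
    obtain i where i: "p $ i \<noteq> 0" using p by (metis vec_eq_iff zero_index)
    define v where "v = sgn (p $ i) *s unit_vec i"
    have pv: "1 \<le> idot p v" using i by (auto simp: v_def idot_scale sgn_if)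
    have prod: "norm1 p \<le> (int (Suc m) + 1) * norm1 p"
      using mult_right_mono[of 1 "int (Suc m) + 1" "norm1 p"] norm1_nonneg[of p] by simp
    show ?case
    proof (rule ccontr)
      assume "\<not> d z \<le> int (k - Suc m)"
      then have big: "int (k - m) \<le> d z" using Suc.prems by simp
      have "(int (Suc m) + 1) * norm1 p \<le> idot p (z + int N *s v) \<and> int (k - m) \<le> d (z + int N *s v)"
        for N
      proof (induction N)
        case 0
        then show ?case using Suc.prems big by simp
      next
        case (Suc N)
        let ?y = "z + int N *s v"
        have y: "(int (Suc m) + 1) * norm1 p \<le> idot p ?y" "int (k - m) \<le> d ?y"
          using Suc.IH by blast+
        have succ: "z + int (Suc N) *s v = ?y + v" by (simp add: algebra_simps)
        have adj: "adjacent ?y (?y + v)" unfolding v_def by (rule adjacent_sgn_step[OF i])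
        have "d (?y + v) = d ?y"
        proof (rule neighbours_eq_of_max[OF _ _ adj])
          show "0 \<le> laplacian d ?y" using y prod by (intro sub) linarith
          show "d y' \<le> d ?y" if "adjacent ?y y'" for y'
            using bound[OF y(1) that] y(2) by linarith
        qed
        then show ?case using y pv unfolding succ by (simp add: idot_add)
      qed
      note ray = this
      \<comment> \<open>Each step \<open>v\<close> raises \<open>idot p\<close> by at least 1, so
        \<open>N\<close> steps pass beyond \<open>T\<close>.\<close>
      define N where "N = nat (\<bar>T\<bar> + \<bar>idot p z\<bar> + 1)"
      have "int N * 1 \<le> int N * idot p v" using pv by (intro mult_left_mono) auto
      moreover have "int N = \<bar>T\<bar> + \<bar>idot p z\<bar> + 1" by (simp add: N_def)
      ultimately have "T < idot p (z + int N *s v)"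
        unfolding idot_add idot_scale by linarith
      then have "d (z + int N *s v) = 0" by (rule far)
      then show False using ray[of N] Suc.prems by simp
    qed
  qed
  from this[of k z] show ?thesis using z d(1)[of z] by simp
qed

text \<open>Moving by \<open>q\<close> changes the level \<open>idot p\<close> by one, so the
  multiples of \<open>q\<close> represent all levels.\<close>

locale primitive_edge =
  fixes p q :: "int ^ 'n"
  assumes pq: "idot p q = 1"
begin

lemma p_nonzero: "p \<noteq> 0"
  using pq by (auto simp: idot_def)

lemma idot_shift [simp]: "idot p (z + q) = idot p z + 1" "idot p (z - q) = idot p z - 1"
  by (simp_all add: idot_add idot_diff pq)

lemma idot_multiple [simp]: "idot p (t *s q) = t"
  by (simp add: idot_scale pq)

lemma edist_to_level:
  "idot p (z - (idot p z - c) *s q) = c"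
  "edist z (z - (idot p z - c) *s q) = \<bar>real_of_int (idot p z - c)\<bar> * norm (\<chi> i. real_of_int (q $ i))"
  unfolding edist_minus_scale by (simp_all add: idot_diff idot_scale pq)

text \<open>Neighbourhoods of the defect are comparable with strips around level 0: the defect lies
  in the strip of half-width \<open>norm1 p\<close> and contains level 0, \<open>idot p\<close> is
  Lipschitz, and level 0 is reached by moving along \<open>q\<close>.\<close>

lemma Theta_edge_iff:
  "G \<in> Theta k (edge p) \<longleftrightarrow> superharmonic G \<and> (\<forall>z. edge p z - int k \<le> G z \<and> G z \<le> edge p z) \<and>
     (\<exists>T. \<forall>z. T < \<bar>idot p z\<bar> \<longrightarrow> G z = edge p z)"
proof -
  have "(\<exists>C>0. {z. edge p z \<noteq> G z} \<subseteq> nbhd C (defect (edge p)))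
      \<longleftrightarrow> (\<exists>T. \<forall>z. T < \<bar>idot p z\<bar> \<longrightarrow> G z = edge p z)" (is "?l = ?r")
  proof
    assume ?l
    then obtain C where C: "C > 0" "{z. edge p z \<noteq> G z} \<subseteq> nbhd C (defect (edge p))" by auto
    define T where "T = norm1 p + \<lceil>real_of_int (norm1 p) * C\<rceil>"
    have "\<bar>idot p z\<bar> \<le> T" if "G z \<noteq> edge p z" for z
    proof -
      from that C have "z \<in> nbhd C (defect (edge p))" by (metis (mono_tags) mem_Collect_eq subsetD)
      then obtain s where s: "s \<in> defect (edge p)" "edist z s \<le> C" by (auto simp: nbhd_def)
      have "\<bar>idot p s\<bar> < norm1 p"
        using s laplacian_edge_eq_0[of p s] by (force simp: defect_def)
      moreover have "\<bar>real_of_int (idot p z - idot p s)\<bar> \<le> real_of_int (norm1 p) * C"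
        using abs_idot_diff_le[of p z s] mult_left_mono[OF s(2), of "real_of_int (norm1 p)"] norm1_nonneg[of p]
        by simp
      then have "real_of_int \<bar>idot p z - idot p s\<bar> \<le> of_int \<lceil>real_of_int (norm1 p) * C\<rceil>"
        by linarith
      ultimately show ?thesis unfolding of_int_le_iff T_def by linarith
    qed
    then show ?r by (metis not_le)
  next
    assume ?r
    then obtain T where T: "\<And>z. T < \<bar>idot p z\<bar> \<Longrightarrow> G z = edge p z" by auto
    let ?nq = "norm (\<chi> i. real_of_int (q $ i))"
    define C where "C = real_of_int \<bar>T\<bar> * ?nq + 1"
    have "z \<in> nbhd C (defect (edge p))" if "edge p z \<noteq> G z" for z
    proof -
      have "\<not> T < \<bar>idot p z\<bar>" using T[of z] that by metis
      then have "real_of_int \<bar>idot p z - 0\<bar> \<le> real_of_int \<bar>T\<bar>" by linarith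
      then have "real_of_int \<bar>idot p z - 0\<bar> * ?nq \<le> real_of_int \<bar>T\<bar> * ?nq"
        by (rule mult_right_mono) simp
      then have "edist z (z - (idot p z - 0) *s q) \<le> C"
        unfolding edist_to_level C_def of_int_abs by linarith
      moreover have "z - (idot p z - 0) *s q \<in> defect (edge p)"
        unfolding defect_def mem_Collect_eq
        by (rule laplacian_edge_neq_0[OF p_nonzero edist_to_level(1)])
      ultimately show ?thesis by (auto simp: nbhd_def)
    qed
    moreover have "C > 0" by (simp add: C_def add_nonneg_pos)
    ultimately show ?l by blast
  qed
  then show ?thesis by (simp add: Theta_def)
qed

lemma Theta_edge_mono: "k \<le> l \<Longrightarrow> Theta k (edge p) \<subseteq> Theta l (edge p)"
proof
  fix G assume "k \<le> l" and G: "G \<in> Theta k (edge p)"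
  have "edge p z - int l \<le> G z" for z
  proof -
    have "edge p z - int k \<le> G z" using G by (simp add: Theta_def)
    then show ?thesis using \<open>k \<le> l\<close> by linarith
  qed
  then show "G \<in> Theta l (edge p)" using G by (simp add: Theta_def)
qed

lemma edge_in_Theta: "edge p \<in> Theta k (edge p)"
  by (simp add: Theta_edge_iff superharmonic_edge)

text \<open>The deficit \<open>edge p - G\<close> is subharmonic outside the strip and at most
  \<open>k\<close>. The resulting bound is uniform in \<open>G\<close>, so it passes to the
  pointwise minimum.\<close>

lemma Theta_support:
  assumes G: "G \<in> Theta k (edge p)" and z: "(int k + 1) * norm1 p \<le> \<bar>idot p z\<bar>"
  shows "G z = edge p z"
proof -
  define d where "d = (\<lambda>z. edge p z - G z)"
  have d: "0 \<le> d z" "d z \<le> int k" for z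
    using G unfolding Theta_edge_iff d_def by (simp_all add: algebra_simps)
  obtain T where T: "\<And>z. T < \<bar>idot p z\<bar> \<Longrightarrow> d z = 0"
    using G unfolding Theta_edge_iff d_def by (metis diff_self)
  have sub: "0 \<le> laplacian d z" if "norm1 p \<le> \<bar>idot p z\<bar>" for z
  proof -
    have "laplacian G z \<le> 0" using G by (simp add: Theta_def superharmonic_def)
    then show ?thesis
      unfolding d_def laplacian_diff laplacian_edge_eq_0[OF that] by simp
  qed
  have "d z = 0"
  proof (cases "0 \<le> idot p z")
    case True
    show ?thesis
    proof (rule subharmonic_vanishes[OF p_nonzero d])
      show "(int k + 1) * norm1 p \<le> idot p z" using z True by simp
      show "norm1 p \<le> idot p z \<Longrightarrow> 0 \<le> laplacian d z" for z by (rule sub) linarith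
      show "T < idot p z \<Longrightarrow> d z = 0" for z by (rule T) linarith
    qed
  next
    case False
    show ?thesis
    proof (rule subharmonic_vanishes[where p = "- p", OF _ d], unfold idot_minus_left norm1_minus)
      show "- p \<noteq> 0" using p_nonzero by simp
      show "(int k + 1) * norm1 p \<le> - idot p z" using z False by simp
      show "norm1 p \<le> - idot p z \<Longrightarrow> 0 \<le> laplacian d z" for z by (rule sub) linarith
      show "T < - idot p z \<Longrightarrow> d z = 0" for z by (rule T) linarith
    qed
  qed
  then show ?thesis by (simp add: d_def)
qed

section \<open>Huskings and their profiles\<close>

abbreviation husk :: "nat \<Rightarrow> int ^ 'n \<Rightarrow> int" where
  "husk k \<equiv> husking k (edge p)"

lemma husk_le: "G \<in> Theta k (edge p) \<Longrightarrow> husk k z \<le> G z"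
  unfolding husking_def by (intro Min_le finite_Theta_values) blast

lemma husk_attained: "\<exists>G\<in>Theta k (edge p). husk k z = G z"
proof -
  have "husk k z \<in> (\<lambda>G. G z) ` Theta k (edge p)"
    unfolding husking_def using edge_in_Theta by (intro Min_in finite_Theta_values) blast
  then show ?thesis by auto
qed

text \<open>At each point the minimum touches one of its members from below, which makes it
  superharmonic; \<open>Theta_support\<close> provides a common strip.\<close>

lemma husk_in_Theta: "husk k \<in> Theta k (edge p)"
proof -
  have "laplacian (husk k) z \<le> 0" for z
  proof -
    obtain G where G: "G \<in> Theta k (edge p)" "husk k z = G z" using husk_attained by blast
    then have "laplacian (husk k) z \<le> laplacian G z"
      by (intro laplacian_mono_touching husk_le)
    also have "\<dots> \<le> 0" using G by (simp add: Theta_def superharmonic_def)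
    finally show ?thesis .
  qed
  moreover have "edge p z - int k \<le> husk k z \<and> husk k z \<le> edge p z" for z
    using husk_attained[of k z] by (auto simp: Theta_def)
  moreover have "husk k z = edge p z" if "(int k + 1) * norm1 p < \<bar>idot p z\<bar>" for z
    using husk_attained[of k z] Theta_support[of _ k z] that by auto
  ultimately show ?thesis unfolding Theta_edge_iff superharmonic_def by blast
qed

lemma husk_eqI: "G \<in> Theta k (edge p) \<Longrightarrow> (\<And>z. G z \<le> husk k z) \<Longrightarrow> G = husk k"
  by (intro ext antisym husk_le) auto

lemma husk_le_husk_translate:
  assumes "idot p v = 0"
  shows "husk k z \<le> husk k (z + v)"
proof (rule husk_le)
  have "edge p (z + v) = edge p z" "idot p (z + v) = idot p z" for z
    using assms by (simp_all add: edge_def idot_add)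
  then show "(\<lambda>z. husk k (z + v)) \<in> Theta k (edge p)"
    using husk_in_Theta[of k] unfolding Theta_edge_iff superharmonic_def laplacian_shift
    by (metis (no_types, lifting))
qed

lemma husk_eq_profile: "husk k z = husk k (idot p z *s q)"
proof -
  define v where "v = idot p z *s q - z"
  have "idot p v = 0" "idot p (- v) = 0"
    by (simp_all add: v_def idot_diff idot_scale pq)
  from this[THEN husk_le_husk_translate, of k] have
    "husk k z \<le> husk k (z + v)" "husk k (z + v) \<le> husk k (z + v + - v)" by blast+
  then show ?thesis by (simp add: v_def)
qed

text \<open>The translate alone exceeds \<open>edge p\<close> far on the negative side. Its minimum
  with the husking is admissible, and minimality of the husking gives the inequality.\<close>

lemma husk_le_shift: "husk k z \<le> husk k (z + q)"
proof -
  have "(\<lambda>z. min (husk k z) (husk k (z + q))) \<in> Theta k (edge p)"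
    unfolding Theta_edge_iff
  proof (intro conjI superharmonic_min allI)
    have H: "superharmonic (husk k)" "\<And>z. edge p z - int k \<le> husk k z \<and> husk k z \<le> edge p z"
      using husk_in_Theta[of k] by (simp_all add: Theta_edge_iff)
    obtain T where T: "\<And>z. T < \<bar>idot p z\<bar> \<Longrightarrow> husk k z = edge p z"
      using husk_in_Theta[of k] unfolding Theta_edge_iff by blast
    have le: "edge p z \<le> edge p (z + q)" for z by (simp add: edge_def)
    show "superharmonic (husk k)" by (rule H)
    show "superharmonic (\<lambda>z. husk k (z + q))"
      using H by (simp add: superharmonic_def laplacian_shift)
    show "min (husk k z) (husk k (z + q)) \<le> edge p z" for z using H by (simp add: min.coboundedI1)
    show "edge p z - int k \<le> min (husk k z) (husk k (z + q))" for z
      using H(2)[of z] H(2)[of "z + q"] le[of z] by simp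
    show "\<exists>T. \<forall>z. T < \<bar>idot p z\<bar> \<longrightarrow> min (husk k z) (husk k (z + q)) = edge p z"
    proof (intro exI allI impI)
      fix z assume "\<bar>T\<bar> + 1 < \<bar>idot p z\<bar>"
      then have "husk k z = edge p z" "husk k (z + q) = edge p (z + q)" by (auto intro!: T)
      then show "min (husk k z) (husk k (z + q)) = edge p z" using le[of z] by simp
    qed
  qed
  from husk_le[OF this, of z] show ?thesis by simp
qed

text \<open>As for the lower bound, with the opposite translate raised by 1, which keeps it above
  \<open>edge p\<close> far out.\<close>

lemma husk_shift_le: "husk k (z + q) \<le> husk k z + 1"
proof -
  have "(\<lambda>z. min (husk k z) (husk k (z - q) + 1)) \<in> Theta k (edge p)"
    unfolding Theta_edge_iff
  proof (intro conjI superharmonic_min allI)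
    have H: "superharmonic (husk k)" "\<And>z. edge p z - int k \<le> husk k z \<and> husk k z \<le> edge p z"
      using husk_in_Theta[of k] by (simp_all add: Theta_edge_iff)
    obtain T where T: "\<And>z. T < \<bar>idot p z\<bar> \<Longrightarrow> husk k z = edge p z"
      using husk_in_Theta[of k] unfolding Theta_edge_iff by blast
    have le: "edge p z \<le> edge p (z - q) + 1" for z by (simp add: edge_def)
    show "superharmonic (husk k)" by (rule H)
    show "superharmonic (\<lambda>z. husk k (z - q) + 1)"
      using H laplacian_shift[of "husk k" "- q"] by (simp add: superharmonic_def laplacian_add)
    show "min (husk k z) (husk k (z - q) + 1) \<le> edge p z" for z using H by (simp add: min.coboundedI1)
    show "edge p z - int k \<le> min (husk k z) (husk k (z - q) + 1)" for z
      using H(2)[of z] H(2)[of "z - q"] le[of z] by simp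
    show "\<exists>T. \<forall>z. T < \<bar>idot p z\<bar> \<longrightarrow> min (husk k z) (husk k (z - q) + 1) = edge p z"
    proof (intro exI allI impI)
      fix z assume "\<bar>T\<bar> + 1 < \<bar>idot p z\<bar>"
      then have "husk k z = edge p z" "husk k (z - q) = edge p (z - q)" by (auto intro!: T)
      then show "min (husk k z) (husk k (z - q) + 1) = edge p z" using le[of z] by simp
    qed
  qed
  from husk_le[OF this, of "z + q"] show ?thesis by simp
qed

lemma slope_01_husk: "\<exists>T. slope_01 p (\<lambda>t. husk k (t *s q)) T"
proof -
  obtain T where T: "\<And>z. T < \<bar>idot p z\<bar> \<Longrightarrow> husk k z = edge p z"
    using husk_in_Theta[of k] unfolding Theta_edge_iff by blast
  have succ: "(t + 1) *s q = t *s q + q" for t :: int by (simp add: algebra_simps)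
  have "slope_01 p (\<lambda>t. husk k (t *s q)) T"
  proof
    fix t
    show "husk k (t *s q) \<le> husk k ((t + 1) *s q)" "husk k ((t + 1) *s q) \<le> husk k (t *s q) + 1"
      unfolding succ by (rule husk_le_shift husk_shift_le)+
    have "line_laplacian p (\<lambda>t. husk k (t *s q)) t = laplacian (\<lambda>z. husk k (idot p z *s q)) (t *s q)"
      by (simp add: laplacian_comp_idot[where f = "\<lambda>t. husk k (t *s q)"])
    also have "\<dots> = laplacian (husk k) (t *s q)" by (simp only: husk_eq_profile[symmetric])
    also have "\<dots> \<le> 0" using husk_in_Theta[of k] by (simp add: Theta_def superharmonic_def)
    finally show "line_laplacian p (\<lambda>t. husk k (t *s q)) t \<le> 0" .
    show "husk k (t *s q) = min 0 t" if "T < \<bar>t\<bar>"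
      using T[of "t *s q"] that by (simp add: edge_def)
  qed
  then show ?thesis ..
qed

text \<open>The depth bound \<open>ge_min\<close> is independent of \<open>k\<close>, so
  \<open>husk k\<close> already belongs to the class of level \<open>husk_width p q\<close>; the
  classes increase with the level.\<close>

lemma husk_stabilises:
  assumes "nat (husk_width p q) \<le> k"
  shows "husk k = husk (nat (husk_width p q))"
proof (rule husk_eqI)
  obtain T where "slope_01 p (\<lambda>t. husk k (t *s q)) T" using slope_01_husk ..
  then interpret slope_01 p "\<lambda>t. husk k (t *s q)" T .
  have "edge p z - husk_width p q \<le> husk k z" for z
    using ge_min[OF pq, of "idot p z"] by (simp add: edge_def husk_eq_profile[symmetric])
  then show "husk k \<in> Theta (nat (husk_width p q)) (edge p)"
    using husk_in_Theta[of k] husk_width_nonneg[of p q] by (simp add: Theta_edge_iff)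
  show "husk k z \<le> husk (nat (husk_width p q)) z" for z
    using Theta_edge_mono[OF assms] husk_in_Theta by (intro husk_le) blast
qed

lemma canonical_husking_eq: "canonical_husking (edge p) = husk (nat (husk_width p q))"
  unfolding canonical_husking_def
proof (rule the_equality)
  show *: "\<forall>\<^sub>F k in sequentially. husk k = husk (nat (husk_width p q))"
    unfolding eventually_sequentially using husk_stabilises by blast
  show "G = husk (nat (husk_width p q))" if G: "\<forall>\<^sub>F k in sequentially. husk k = G" for G
  proof -
    obtain k where "husk k = G \<and> husk k = husk (nat (husk_width p q))"
      using eventually_happens[OF eventually_conj[OF G *]] by auto
    then show ?thesis by metis
  qed
qed

lemma canonical_husking_le:
  assumes "G \<in> Theta k (edge p)"
  shows "canonical_husking (edge p) z \<le> G z"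
proof -
  let ?l = "max k (nat (husk_width p q))"
  have "G \<in> Theta ?l (edge p)" using assms Theta_edge_mono[of k ?l] by auto
  then have "husk ?l z \<le> G z" by (rule husk_le)
  then show ?thesis using husk_stabilises[of ?l] by (simp add: canonical_husking_eq)
qed

end

subsection \<open>Relaxation and the least action principle\<close>

text \<open>States are thus determined by the odometer, through its Laplacian.\<close>

lemma topple_eq_laplacian: "topple z \<phi> = (\<lambda>x. \<phi> x + laplacian (\<lambda>y. if y = z then 1 else 0) x)"
proof
  fix x
  have "(\<Sum>z' | adjacent x z'. if z' = z then 1 else 0) = (if z \<in> {z'. adjacent x z'} then 1 else 0 :: int)"
    by (rule sum.delta[OF finite_adjacent])
  then show "topple z \<phi> x = \<phi> x + laplacian (\<lambda>y. if y = z then 1 else 0) x"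
    by (simp add: topple_def laplacian_def adjacent_commute)
qed

lemma laplacian_fun_upd_add1: "laplacian (H(z := H z + 1)) x = laplacian H x + laplacian (\<lambda>y. if y = z then 1 else 0) x"
proof -
  have "H(z := H z + 1) = (\<lambda>y. H y + (if y = z then 1 else 0))" by auto
  then show ?thesis by (simp only: laplacian_add)
qed

text \<open>The odometer \<open>h i\<close> counts the topplings performed at each vertex before step \<open>i\<close>.\<close>

definition legal_odometer :: "(int ^ 'n \<Rightarrow> int) \<Rightarrow> (nat \<Rightarrow> int ^ 'n \<Rightarrow> int) \<Rightarrow> bool" where
  "legal_odometer \<phi> h \<longleftrightarrow> h 0 = (\<lambda>z. 0) \<and>
     (\<forall>i. h (Suc i) = h i \<or>
       (\<exists>z. legal z (\<lambda>x. \<phi> x + laplacian (h i) x) \<and> h (Suc i) = (h i)(z := h i z + 1)))"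

text \<open>A first excess would be a toppling at \<open>x\<close> with \<open>h i x = H x\<close>
  and \<open>h i\<close> below \<open>H\<close>; comparing Laplacians at the touching point shows
  that \<open>x\<close> holds too few grains.\<close>

lemma legal_odometer_le:
  assumes h: "legal_odometer \<phi> h" and H: "\<And>z. 0 \<le> H z" "stable (\<lambda>z. \<phi> z + laplacian H z)"
  shows "h i z \<le> H z"
proof (induction i arbitrary: z)
  case 0
  then show ?case using h H by (simp add: legal_odometer_def)
next
  case (Suc i)
  show ?case
  proof (cases "h (Suc i) = h i")
    case True
    then show ?thesis using Suc by simp
  next
    case False
    then obtain x where x: "legal x (\<lambda>x. \<phi> x + laplacian (h i) x)" "h (Suc i) = (h i)(x := h i x + 1)"
      using h by (auto simp: legal_odometer_def)
    have "h i x \<noteq> H x"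
    proof
      assume "h i x = H x"
      then have "laplacian (h i) x \<le> laplacian H x" by (intro laplacian_mono_touching Suc.IH)
      moreover have "\<phi> x + laplacian H x \<le> 2 * int CARD('a) - 1" using H(2) by (simp add: stable_def)
      ultimately show False using x(1) by (simp add: legal_def)
    qed
    then have "h i x + 1 \<le> H x" using Suc[of x] by simp
    then show ?thesis using Suc x by simp
  qed
qed

lemma legal_odometer_mono:
  assumes "legal_odometer \<phi> h" "i \<le> j"
  shows "h i z \<le> h j z"
  using assms(2)
proof (induction j rule: dec_induct)
  case (step j)
  from assms(1) have "h (Suc j) = h j \<or> (\<exists>x. h (Suc j) = (h j)(x := h j x + 1))"
    unfolding legal_odometer_def by blast
  then have "h j z \<le> h (Suc j) z" by auto
  then show ?case using step.IH by linarith
qed simp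

lemma laplacian_eventually_const:
  assumes "\<And>z. \<forall>\<^sub>F i in sequentially. h i z = H z"
  shows "\<forall>\<^sub>F i in sequentially. laplacian (h i) z = laplacian H z"
proof -
  have "\<forall>\<^sub>F i in sequentially. \<forall>x\<in>insert z {z'. adjacent z z'}. h i x = H x"
    using finite_adjacent[of z] assms by (intro eventually_ball_finite) auto
  then show ?thesis
    by eventually_elim (simp add: laplacian_def)
qed

text \<open>The states do not record which vertex toppled, so the odometer is rebuilt by dependent
  choice.\<close>

lemma relaxes_to_odometer:
  assumes "relaxes_to \<phi> \<phi>'"
  obtains h H where "legal_odometer \<phi> h" "\<And>z. \<forall>\<^sub>F i in sequentially. h i z = H z"
    "\<phi>' = (\<lambda>z. \<phi> z + laplacian H z)"
proof -
  from assms obtain X where X: "X 0 = \<phi>"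
    "\<And>i. X (Suc i) = X i \<or> (\<exists>z. legal z (X i) \<and> X (Suc i) = topple z (X i))"
    "\<And>x. \<forall>\<^sub>F i in sequentially. X i x = \<phi>' x"
    unfolding relaxes_to_def by blast
  have "\<exists>h. \<forall>i. X i = (\<lambda>x. \<phi> x + laplacian (h i) x) \<and> (i = 0 \<longrightarrow> h i = (\<lambda>z. 0)) \<and>
      (h (Suc i) = h i \<or> (\<exists>z. legal z (X i) \<and> h (Suc i) = (h i)(z := h i z + 1)))"
  proof (rule exE[OF dependent_nat_choice[where
        P = "\<lambda>i g. X i = (\<lambda>x. \<phi> x + laplacian g x) \<and> (i = 0 \<longrightarrow> g = (\<lambda>z. 0))" and
        Q = "\<lambda>i g g'. g' = g \<or> (\<exists>z. legal z (X i) \<and> g' = g(z := g z + 1))"]])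
    show "\<exists>g. X 0 = (\<lambda>x. \<phi> x + laplacian g x) \<and> (0 = 0 \<longrightarrow> g = (\<lambda>z. 0))"
      using X(1) by (intro exI[of _ "\<lambda>z. 0"]) auto
  next
    fix g i
    assume g: "X i = (\<lambda>x. \<phi> x + laplacian g x) \<and> (i = 0 \<longrightarrow> g = (\<lambda>z. 0))"
    from X(2)[of i] show "\<exists>g'. (X (Suc i) = (\<lambda>x. \<phi> x + laplacian g' x) \<and> (Suc i = 0 \<longrightarrow> g' = (\<lambda>z. 0))) \<and>
        (g' = g \<or> (\<exists>z. legal z (X i) \<and> g' = g(z := g z + 1)))"
    proof
      assume "X (Suc i) = X i"
      then show ?thesis using g by (intro exI[of _ g]) auto
    next
      assume "\<exists>z. legal z (X i) \<and> X (Suc i) = topple z (X i)"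
      then obtain z where z: "legal z (X i)" "X (Suc i) = topple z (X i)" by auto
      have "X (Suc i) = (\<lambda>x. \<phi> x + laplacian (g(z := g z + 1)) x)"
        unfolding z(2) topple_eq_laplacian laplacian_fun_upd_add1 using g by auto
      then show ?thesis using z(1) by (intro exI[of _ "g(z := g z + 1)"]) auto
    qed
  next
    fix h
    assume "\<forall>i. (X i = (\<lambda>x. \<phi> x + laplacian (h i) x) \<and> (i = 0 \<longrightarrow> h i = (\<lambda>z. 0))) \<and>
        (h (Suc i) = h i \<or> (\<exists>z. legal z (X i) \<and> h (Suc i) = (h i)(z := h i z + 1)))"
    then show ?thesis by (intro exI[of _ h]) blast
  qed
  then obtain h where h: "\<And>i. X i = (\<lambda>x. \<phi> x + laplacian (h i) x)" "h 0 = (\<lambda>z. 0)"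
    "\<And>i. h (Suc i) = h i \<or> (\<exists>z. legal z (X i) \<and> h (Suc i) = (h i)(z := h i z + 1))"
    by metis
  have "\<exists>c. \<forall>\<^sub>F i in sequentially. h i z = c" for z
  proof -
    obtain N where N: "\<And>i. N \<le> i \<Longrightarrow> X i z = \<phi>' z"
      using X(3)[of z] by (auto simp: eventually_sequentially)
    have "h i z = h N z" if "N \<le> i" for i
      using that
    proof (induction i rule: dec_induct)
      case (step i)
      \<comment> \<open>A toppling at \<open>z\<close> removes \<open>2n\<close> grains there, which
        is excluded once the state at \<open>z\<close> is constant.\<close>
      have "h (Suc i) \<noteq> (h i)(z := h i z + 1)"
      proof
        assume "h (Suc i) = (h i)(z := h i z + 1)"
        then have "X (Suc i) z = topple z (X i) z"
          unfolding topple_eq_laplacian h(1) by (simp only: laplacian_fun_upd_add1 add.assoc)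
        then show False using N[of i] N[of "Suc i"] step.hyps by (simp add: topple_def)
      qed
      then show ?case using h(3)[of i] step.IH by (metis fun_upd_apply)
    qed simp
    then show ?thesis by (auto simp: eventually_sequentially)
  qed
  then obtain H where H: "\<And>z. \<forall>\<^sub>F i in sequentially. h i z = H z" by metis
  have "\<phi>' x = \<phi> x + laplacian H x" for x
  proof -
    have "\<forall>\<^sub>F i in sequentially. \<phi>' x = \<phi> x + laplacian H x"
      using X(3)[of x] laplacian_eventually_const[where h = h and H = H, OF H, of x]
      by eventually_elim (metis h(1))
    then show ?thesis by simp
  qed
  moreover have "legal_odometer \<phi> h"
    unfolding legal_odometer_def h(1)[symmetric] using h(2,3) by blast
  ultimately show ?thesis using that[of h H] H by blast
qed

lemma least_action:
  assumes "relaxes_to \<phi> \<phi>'"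
  obtains H where "\<phi>' = (\<lambda>z. \<phi> z + laplacian H z)" "\<And>z. 0 \<le> H z"
    "\<And>K z. (\<And>z. 0 \<le> K z) \<Longrightarrow> stable (\<lambda>z. \<phi> z + laplacian K z) \<Longrightarrow> H z \<le> K z"
proof -
  obtain h H where h: "legal_odometer \<phi> h" and H: "\<And>z. \<forall>\<^sub>F i in sequentially. h i z = H z"
    and eq: "\<phi>' = (\<lambda>z. \<phi> z + laplacian H z)"
    using relaxes_to_odometer[OF assms] by metis
  have attained: "\<exists>i. h i z = H z" for z using eventually_happens[OF H] by auto
  show ?thesis
  proof
    show "\<phi>' = (\<lambda>z. \<phi> z + laplacian H z)" by (rule eq)
    show "0 \<le> H z" for z
    proof -
      obtain i where "h i z = H z" using attained ..
      moreover have "h 0 z = 0" using h by (simp add: legal_odometer_def)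
      ultimately show ?thesis using legal_odometer_mono[OF h, of 0 i z] by simp
    qed
    show "H z \<le> K z" if "\<And>z. 0 \<le> K z" "stable (\<lambda>z. \<phi> z + laplacian K z)" for K z
      using attained[of z] legal_odometer_le[OF h that] by metis
  qed
qed

text \<open>Each limit odometer stabilises the state, so by least action each is below the
  other.\<close>

lemma relaxes_to_unique:
  assumes "relaxes_to \<phi> \<phi>'" "relaxes_to \<phi> \<phi>''"
  shows "\<phi>' = \<phi>''"
proof -
  obtain H where H: "\<phi>' = (\<lambda>z. \<phi> z + laplacian H z)" "\<And>z. 0 \<le> H z"
    "\<And>K z. (\<And>z. 0 \<le> K z) \<Longrightarrow> stable (\<lambda>z. \<phi> z + laplacian K z) \<Longrightarrow> H z \<le> K z"
    using least_action[OF assms(1)] by metis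
  obtain K where K: "\<phi>'' = (\<lambda>z. \<phi> z + laplacian K z)" "\<And>z. 0 \<le> K z"
    "\<And>H z. (\<And>z. 0 \<le> H z) \<Longrightarrow> stable (\<lambda>z. \<phi> z + laplacian H z) \<Longrightarrow> K z \<le> H z"
    using least_action[OF assms(2)] by metis
  have "stable \<phi>'" "stable \<phi>''" using assms by (auto simp: relaxes_to_def)
  then have "H = K" using H K by (intro ext antisym) auto
  then show ?thesis using H K by simp
qed

section \<open>Existence and computation of the relaxation\<close>

lemma bounded_mono_eventually_const:
  fixes a :: "nat \<Rightarrow> int"
  assumes mono: "\<And>i j. i \<le> j \<Longrightarrow> a i \<le> a j" and bound: "\<And>i. a i \<le> b"
  shows "\<exists>c. \<forall>\<^sub>F i in sequentially. a i = c"
proof -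
  have "finite {a 0..b}" by simp
  moreover have "range a \<subseteq> {a 0..b}" using mono bound by auto
  ultimately have fin: "finite (range a)" by (rule finite_subset[rotated])
  then have "Max (range a) \<in> range a" by (intro Max_in) auto
  then obtain N where N: "Max (range a) = a N" by auto
  have "a i = a N" if "N \<le> i" for i
    using mono[OF that] Max_ge[OF fin, of "a i"] N by simp
  then show ?thesis by (auto simp: eventually_sequentially)
qed

text \<open>The schedule below visits every vertex infinitely often, so no legal toppling is postponed forever.\<close>

lemma relaxes_to_exists:
  fixes \<phi> H :: "int ^ 'n \<Rightarrow> int"
  assumes H: "\<And>z. 0 \<le> H z" "stable (\<lambda>z. \<phi> z + laplacian H z)"
  shows "\<exists>\<phi>'. relaxes_to \<phi> \<phi>'"
proof -
  \<comment> \<open>The second component of the decoded pair only serves to repeat every vertex at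
    arbitrarily late times.\<close>
  define v :: "nat \<Rightarrow> int ^ 'n" where "v i = from_nat (fst (prod_decode i))" for i
  have visits: "\<exists>i\<ge>N. v i = x" for N x
    by (intro exI[of _ "prod_encode (to_nat x, N)"]) (simp add: v_def le_prod_encode_2)
  define h where "h = rec_nat (\<lambda>z. 0) (\<lambda>i g.
    if legal (v i) (\<lambda>x. \<phi> x + laplacian g x) then g(v i := g (v i) + 1) else g)"
  define X where "X i = (\<lambda>x. \<phi> x + laplacian (h i) x)" for i
  have h0: "h 0 = (\<lambda>z. 0)"
    and hS: "h (Suc i) = (if legal (v i) (X i) then (h i)(v i := h i (v i) + 1) else h i)" for i
    by (simp_all add: h_def X_def)
  have odo: "legal_odometer \<phi> h" unfolding legal_odometer_def X_def[symmetric] using h0 hS by metis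
  have "\<exists>c. \<forall>\<^sub>F i in sequentially. h i z = c" for z
    by (rule bounded_mono_eventually_const[OF legal_odometer_mono[OF odo] legal_odometer_le[OF odo H]])
  then obtain K where K: "\<And>z. \<forall>\<^sub>F i in sequentially. h i z = K z" by metis
  define \<phi>' where "\<phi>' = (\<lambda>z. \<phi> z + laplacian K z)"
  have XS: "X (Suc i) = topple (v i) (X i)" if "legal (v i) (X i)" for i
    using that hS[of i] unfolding topple_eq_laplacian X_def by (simp only: if_True laplacian_fun_upd_add1 add.assoc)
  have lim: "\<forall>\<^sub>F i in sequentially. X i x = \<phi>' x" for x
    using laplacian_eventually_const[where h = h and H = K, OF K, of x] unfolding X_def \<phi>'_def by eventually_elim simp
  have "\<phi>' x \<le> 2 * int CARD('n) - 1" for x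
  proof (rule ccontr)
    assume "\<not> \<phi>' x \<le> 2 * int CARD('n) - 1"
    moreover obtain N where N: "\<And>i. N \<le> i \<Longrightarrow> X i x = \<phi>' x"
      using lim[of x] by (auto simp: eventually_sequentially)
    moreover obtain i where i: "N \<le> i" "v i = x" using visits by blast
    ultimately have "legal (v i) (X i)" by (simp add: legal_def)
    from XS[OF this] N[of i] N[of "Suc i"] i show False by (simp add: topple_def)
  qed
  moreover have "X (Suc i) = X i \<or> (\<exists>z. legal z (X i) \<and> X (Suc i) = topple z (X i))" for i
    using XS[of i] hS[of i] by (cases "legal (v i) (X i)") (auto simp: X_def)
  moreover have "X 0 = \<phi>" by (simp add: X_def h0)
  ultimately have "relaxes_to \<phi> \<phi>'"
    unfolding relaxes_to_def stable_def using lim by blast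
  then show ?thesis by blast
qed

text \<open>The least stabilising odometer lies below \<open>H\<close>, so minimality of
  \<open>H\<close> among smaller ones identifies it.\<close>

lemma relaxation_eq:
  assumes H: "\<And>z. 0 \<le> H z" "stable (\<lambda>z. \<phi> z + laplacian H z)"
    and least: "\<And>K. (\<And>z. 0 \<le> K z \<and> K z \<le> H z) \<Longrightarrow> stable (\<lambda>z. \<phi> z + laplacian K z) \<Longrightarrow> K = H"
  shows "relaxation \<phi> = (\<lambda>z. \<phi> z + laplacian H z)"
proof -
  obtain \<phi>' where \<phi>': "relaxes_to \<phi> \<phi>'" using relaxes_to_exists[OF H] ..
  obtain K where K: "\<phi>' = (\<lambda>z. \<phi> z + laplacian K z)" "\<And>z. 0 \<le> K z"
    "\<And>H z. (\<And>z. 0 \<le> H z) \<Longrightarrow> stable (\<lambda>z. \<phi> z + laplacian H z) \<Longrightarrow> K z \<le> H z"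
    using least_action[OF \<phi>'] by metis
  have "stable \<phi>'" using \<phi>' by (simp add: relaxes_to_def)
  then have "K = H" using K(2) K(3)[OF H] unfolding K(1) by (intro least) auto
  moreover have "relaxation \<phi> = \<phi>'"
    unfolding relaxation_def using \<phi>' relaxes_to_unique[OF _ \<phi>'] by (rule the_equality)
  ultimately show ?thesis using K by simp
qed

text \<open>In terms of the function \<open>F\<close> defining the state, stability after toppling \<open>K\<close> times
  says that \<open>F + K\<close> is superharmonic.\<close>

lemma wave_eq:
  fixes F H :: "int ^ 'n \<Rightarrow> int"
  assumes z0: "laplacian F z0 = 0" "adjacent z0 z1" "laplacian F z1 = 0"
    and H: "\<And>z. 0 \<le> H z" "H z0 = 1" "superharmonic (\<lambda>z. F z + H z)"
    and least: "\<And>K. (\<And>z. 0 \<le> K z \<and> K z \<le> H z) \<Longrightarrow> K z0 = 1 \<Longrightarrow>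
      superharmonic (\<lambda>z. F z + K z) \<Longrightarrow> K = H"
  shows "wave z0 (\<lambda>z. 2 * int CARD('n) - 1 + laplacian F z) z
    = 2 * int CARD('n) - 1 + laplacian (\<lambda>z. F z + H z) z"
proof -
  \<comment> \<open>The forced first toppling; the odometer of the relaxation is the total count
    minus \<open>?d\<close>.\<close>
  let ?d = "\<lambda>y. if y = z0 then 1 else 0 :: int"
  let ?\<phi> = "\<lambda>z. 2 * int CARD('n) - 1 + laplacian F z"
  have state: "topple z0 ?\<phi> x + laplacian K x
      = 2 * int CARD('n) - 1 + laplacian (\<lambda>z. F z + (K z + ?d z)) x" for K x
    by (simp only: topple_eq_laplacian laplacian_add)
  have stable: "stable (\<lambda>z. topple z0 ?\<phi> z + laplacian K z) \<longleftrightarrow> superharmonic (\<lambda>z. F z + (K z + ?d z))" for K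
    unfolding stable_def superharmonic_def state by (intro iff_allI) linarith
  have "relaxation (topple z0 ?\<phi>) = (\<lambda>z. topple z0 ?\<phi> z + laplacian (\<lambda>z. H z - ?d z) z)"
  proof (rule relaxation_eq)
    show "0 \<le> H z - ?d z" for z using H by auto
    show "stable (\<lambda>z. topple z0 ?\<phi> z + laplacian (\<lambda>z. H z - ?d z) z)"
      unfolding stable using H(3) by simp
    fix K
    assume K: "\<And>z. 0 \<le> K z \<and> K z \<le> H z - ?d z"
      and "stable (\<lambda>z. topple z0 ?\<phi> z + laplacian K z)"
    then have "superharmonic (\<lambda>z. F z + (K z + ?d z))" unfolding stable by blast
    moreover have "0 \<le> K z + ?d z \<and> K z + ?d z \<le> H z" for z using K[of z] by auto
    moreover have "K z0 + ?d z0 = 1" using K[of z0] H(2) by simp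
    ultimately have "(\<lambda>z. K z + ?d z) = H" by (intro least)
    from fun_cong[OF this] have "K z + ?d z = H z" for z .
    then show "K = (\<lambda>z. H z - ?d z)" by (intro ext) (metis add_diff_cancel_right')
  qed
  moreover have "wave z0 ?\<phi> = relaxation (topple z0 ?\<phi>)"
    unfolding wave_def using z0 by auto
  ultimately show ?thesis unfolding state by simp
qed

subsection \<open>Waves on the husking of an edge\<close>

text \<open>A zero of \<open>K\<close> is a minimum, hence spreads to all neighbours, and
  connectedness of the half-space carries it to \<open>z0\<close>.\<close>

lemma nonneg_superharmonic_on_halfspace:
  assumes "\<And>z. 0 \<le> K z" "\<And>z. idot p z < c \<Longrightarrow> laplacian K z \<le> 0"
    and "K z0 \<noteq> 0" "idot p z0 < c" "idot p z < c"
  shows "K z \<noteq> 0"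
proof
  assume "K z = 0"
  have "z0 \<in> {z. K z = 0}"
  proof (rule halfspace_connected[of p c _ z])
    fix y y' assume "idot p y < c" "adjacent y y'" "y \<in> {z. K z = 0}"
    then have "K y' = K y" using assms(1,2) by (intro neighbours_eq_of_min) auto
    then show "y' \<in> {z. K z = 0}" using \<open>y \<in> _\<close> by simp
  qed (use assms \<open>K z = 0\<close> in auto)
  then show False using assms(3) by simp
qed

context primitive_edge
begin

section \<open>The canonical husking and its defect\<close>

abbreviation canon :: "int ^ 'n \<Rightarrow> int" where
  "canon \<equiv> canonical_husking (edge p)"

abbreviation W :: int where
  "W \<equiv> husk_width p q"

lemma canonical_in_Theta: "canon \<in> Theta (nat W) (edge p)"
  unfolding canonical_husking_eq by (rule husk_in_Theta)

lemma superharmonic_canonical: "laplacian canon z \<le> 0"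
  using canonical_in_Theta by (simp add: Theta_def superharmonic_def)

lemma canonical_bounds: "edge p z - W \<le> canon z" "canon z \<le> edge p z"
  using canonical_in_Theta husk_width_nonneg[of p q] by (simp_all add: Theta_def)

lemma canonical_increment: "canon z \<le> canon (z + q)" "canon (z + q) \<le> canon z + 1"
  unfolding canonical_husking_eq by (rule husk_le_shift husk_shift_le)+

lemma canonical_eq_edge:
  assumes "W \<le> \<bar>idot p z\<bar>"
  shows "canon z = edge p z"
proof -
  obtain T where "slope_01 p (\<lambda>t. husk (nat W) (t *s q)) T" using slope_01_husk ..
  then interpret slope_01 p "\<lambda>t. husk (nat W) (t *s q)" T .
  show ?thesis
    using eq_min[OF pq assms] by (simp add: edge_def canonical_husking_eq husk_eq_profile[symmetric])
qed

lemma laplacian_canonical_eq_0: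
  assumes "W + norm1 p \<le> \<bar>idot p z\<bar>"
  shows "laplacian canon z = 0"
proof -
  have "canon y = edge p y" if "adjacent z y \<or> y = z" for y
    using that adjacent_idot_le[of z y p] assms norm1_nonneg[of p] by (intro canonical_eq_edge) auto
  then have "laplacian canon z = laplacian (edge p) z"
    by (intro antisym laplacian_mono_touching) auto
  also have "\<dots> = 0"
    using assms husk_width_nonneg[of p q] by (intro laplacian_edge_eq_0) auto
  finally show ?thesis .
qed

lemma laplacian_canonical_cong:
  assumes "idot p z = idot p z'"
  shows "laplacian canon z = laplacian canon z'"
proof -
  have "canon = (\<lambda>z. husk (nat W) (idot p z *s q))"
    unfolding canonical_husking_eq using husk_eq_profile by blast
  then have "laplacian canon z = line_laplacian p (\<lambda>t. husk (nat W) (t *s q)) (idot p z)" for z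
    using laplacian_comp_idot[where f = "\<lambda>t. husk (nat W) (t *s q)"] by simp
  then show ?thesis using assms by simp
qed

text \<open>Were \<open>canon\<close> harmonic, its maximum 0 at \<open>W *s q\<close> would spread
  to negative levels. With an empty defect every point would count as far from it.\<close>

lemma defect_canonical_nonempty: "defect canon \<noteq> {}"
proof
  assume "defect canon = {}"
  then have harm: "laplacian canon z = 0" for z by (auto simp: defect_def)
  have W: "0 \<le> W" by (rule husk_width_nonneg)
  define a where "a = - (W + 1)"
  have "a *s q \<in> {z. canon z = 0}"
  proof (rule halfspace_connected[of p "W + 1" _ "W *s q"])
    fix z z' assume z: "adjacent z z'" "z \<in> {z. canon z = 0}"
    have "canon y \<le> 0" for y using canonical_bounds(2)[of y] by (simp add: edge_def)
    then have "canon z' = canon z" using z harm by (intro neighbours_eq_of_max) auto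
    then show "z' \<in> {z. canon z = 0}" using z by simp
  qed (use W canonical_eq_edge[of "W *s q"] in \<open>auto simp: edge_def a_def\<close>)
  moreover have "canon (a *s q) = a" using W canonical_eq_edge[of "a *s q"] by (simp add: edge_def a_def)
  ultimately show False using W by (simp add: a_def)
qed

text \<open>The defect is a union of levels. Moving \<open>z\<close> along \<open>q\<close> to the
  level of one fixed defect point gives a defect point at controlled distance.\<close>

lemma far_from_defect:
  assumes "0 \<le> B"
  shows "\<exists>R>0. \<forall>z. (\<forall>s\<in>defect canon. R < edist z s) \<longrightarrow> B < \<bar>idot p z\<bar>"
proof -
  obtain s where s: "s \<in> defect canon" using defect_canonical_nonempty by blast
  define c where "c = idot p s"
  let ?nq = "norm (\<chi> i. real_of_int (q $ i))"
  define R where "R = real_of_int (B + \<bar>c\<bar>) * ?nq + 1"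
  have "0 < R" unfolding R_def using assms by (intro add_nonneg_pos mult_nonneg_nonneg) auto
  moreover have "B < \<bar>idot p z\<bar>" if far: "\<forall>s\<in>defect canon. R < edist z s" for z
  proof (rule ccontr)
    assume "\<not> B < \<bar>idot p z\<bar>"
    then have "\<bar>idot p z - c\<bar> \<le> B + \<bar>c\<bar>" by linarith
    then have le: "\<bar>real_of_int (idot p z - c)\<bar> \<le> real_of_int (B + \<bar>c\<bar>)"
      unfolding of_int_abs[symmetric] of_int_le_iff .
    let ?y = "z - (idot p z - c) *s q"
    have "idot p ?y = idot p s" unfolding edist_to_level(1) c_def ..
    then have "?y \<in> defect canon" using s laplacian_canonical_cong[of ?y s] by (simp add: defect_def)
    then have "R < \<bar>real_of_int (idot p z - c)\<bar> * ?nq"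
      using far edist_to_level(2) by metis
    moreover have "\<bar>real_of_int (idot p z - c)\<bar> * ?nq \<le> real_of_int (B + \<bar>c\<bar>) * ?nq"
      using le by (rule mult_right_mono) simp
    ultimately show False unfolding R_def by linarith
  qed
  ultimately show ?thesis by blast
qed

lemma laplacian_odometer_le_0:
  assumes "superharmonic (\<lambda>z. canon z + K z)" "W + norm1 p \<le> \<bar>idot p z\<bar>"
  shows "laplacian K z \<le> 0"
  using assms laplacian_canonical_eq_0[of z]
  unfolding superharmonic_def laplacian_add by (metis add_0)

section \<open>The waves sent from the two sides\<close>

lemma edge_shift: "edge p z \<le> edge p (z + q)" "edge p (z + q) \<le> edge p z + 1"
  by (simp_all add: edge_def)

text \<open>In both cases the candidate odometer is the difference of \<open>canon\<close> and a translate.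
  A smaller one, translated back, would give an element of \<open>Theta\<close> below \<open>canon\<close>.\<close>

lemma wave_negative_side:
  assumes z0: "idot p z0 < - (W + 2 * norm1 p + 1)"
  shows "wave z0 (\<lambda>z. 2 * int CARD('n) - 1 + laplacian canon z) z
    = 2 * int CARD('n) - 1 + laplacian canon (z + q)"
proof -
  define H where "H z = canon (z + q) - canon z" for z
  have n1: "0 \<le> norm1 p" by (rule norm1_nonneg)
  have W: "0 \<le> W" by (rule husk_width_nonneg)
  have sum: "(\<lambda>z. canon z + H z) = (\<lambda>z. canon (z + q))" by (simp add: H_def)
  have H01: "0 \<le> H z" "H z \<le> 1" for z using canonical_increment[of z] by (auto simp: H_def)
  \<comment> \<open>Any direction provides the neighbour that sending a wave requires.\<close>
  obtain i :: 'n where True by simp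
  define z1 where "z1 = z0 + unit_vec i"
  have adj: "adjacent z0 z1" by (auto simp: adjacent_iff z1_def)
  have z1: "W + norm1 p \<le> \<bar>idot p z1\<bar>" using adjacent_idot_le[OF adj, of p] z0 by linarith
  have "wave z0 (\<lambda>z. 2 * int CARD('n) - 1 + laplacian canon z) z
    = 2 * int CARD('n) - 1 + laplacian (\<lambda>z. canon z + H z) z"
  proof (rule wave_eq[OF _ adj])
    show "laplacian canon z0 = 0" using z0 W n1 by (intro laplacian_canonical_eq_0) linarith
    show "laplacian canon z1 = 0" using z1 by (rule laplacian_canonical_eq_0)
    show "0 \<le> H z" for z by (rule H01)
    have "canon z0 = edge p z0" "canon (z0 + q) = edge p (z0 + q)"
      using z0 W n1 by (auto intro!: canonical_eq_edge)
    then show "H z0 = 1" using z0 W n1 by (simp add: H_def edge_def)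
    show "superharmonic (\<lambda>z. canon z + H z)"
      unfolding sum superharmonic_def laplacian_shift using superharmonic_canonical by blast
    fix K
    assume K: "\<And>z. 0 \<le> K z \<and> K z \<le> H z" and Kz0: "K z0 = 1"
      and super: "superharmonic (\<lambda>z. canon z + K z)"
    \<comment> \<open>On this half-space \<open>canon\<close> is harmonic, so \<open>K\<close> is
      superharmonic there and \<open>K z0 = 1\<close> excludes zeros.\<close>
    have K1: "K z = 1" if "idot p z < - (W + norm1 p)" for z
    proof -
      have "K z \<noteq> 0"
      proof (rule nonneg_superharmonic_on_halfspace[where ?z0.0 = z0, OF _ _ _ _ that])
        show "laplacian K y \<le> 0" if "idot p y < - (W + norm1 p)" for y
          using that by (intro laplacian_odometer_le_0[OF super]) linarith
      qed (use K Kz0 z0 n1 in auto)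
      then show ?thesis using K[of z] H01[of z] by linarith
    qed
    \<comment> \<open>For \<open>K = H\<close> this is \<open>canon\<close> itself. Translation
      lowers \<open>edge p\<close> by at most 1, hence the level \<open>W + 1\<close>.\<close>
    define G where "G = (\<lambda>z. canon (z - q) + K (z - q))"
    have "G \<in> Theta (nat (W + 1)) (edge p)"
      unfolding Theta_edge_iff
    proof (intro conjI allI exI impI)
      show "superharmonic G"
        using super laplacian_shift[of "\<lambda>z. canon z + K z" "- q"] by (simp add: superharmonic_def G_def)
      show "G z \<le> edge p z" for z
        using K[of "z - q"] canonical_bounds(2)[of z] by (simp add: G_def H_def)
      show "edge p z - int (nat (W + 1)) \<le> G z" for z
        using K[of "z - q"] canonical_bounds(1)[of "z - q"] edge_shift(2)[of "z - q"] W
        by (simp add: G_def)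
      \<comment> \<open>Far on the zero side \<open>H\<close> and hence \<open>K\<close> vanish; far
        on the negative side \<open>K = 1\<close> makes up for the drop of \<open>edge p\<close>
        along \<open>- q\<close>.\<close>
      show "G z = edge p z" if "W + norm1 p + 1 < \<bar>idot p z\<bar>" for z
      proof -
        have eq: "canon z = edge p z" "canon (z - q) = edge p (z - q)"
          using that n1 by (auto intro!: canonical_eq_edge)
        show ?thesis
        proof (cases "0 \<le> idot p z")
          case True
          then have "H (z - q) = 0" using eq that W n1 by (simp add: H_def edge_def)
          then have "K (z - q) = 0" using K[of "z - q"] by linarith
          then show ?thesis using eq True that W n1 by (simp add: G_def edge_def)
        next
          case False
          then have "K (z - q) = 1" using that by (intro K1) simp
          then show ?thesis using eq False by (simp add: G_def edge_def)
        qed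
      qed
    qed
    then have "canon (z + q) \<le> G (z + q)" for z by (rule canonical_husking_le)
    then have "canon (z + q) \<le> canon z + K z" for z by (simp add: G_def)
    then have "H z \<le> K z" for z unfolding H_def by (metis diff_le_eq add.commute)
    then show "K = H" using K by (intro ext antisym) auto
  qed
  then show ?thesis unfolding sum laplacian_shift .
qed

lemma wave_zero_side:
  assumes z0: "W + 2 * norm1 p + 1 < idot p z0"
  shows "wave z0 (\<lambda>z. 2 * int CARD('n) - 1 + laplacian canon z) z
    = 2 * int CARD('n) - 1 + laplacian canon (z - q)"
proof -
  define H where "H z = canon (z - q) + 1 - canon z" for z
  have n1: "0 \<le> norm1 p" by (rule norm1_nonneg)
  have W: "0 \<le> W" by (rule husk_width_nonneg)
  \<comment> \<open>The constant 1 makes \<open>H\<close> equal to 1 far on the zero side and 0 far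
    on the negative side; writing \<open>z + - q\<close> fits
    \<open>laplacian_shift\<close>.\<close>
  have sum: "(\<lambda>z. canon z + H z) = (\<lambda>z. canon (z + - q) + 1)" by (simp add: H_def)
  have H01: "0 \<le> H z" "H z \<le> 1" for z using canonical_increment[of "z - q"] by (auto simp: H_def)
  obtain i :: 'n where True by simp
  define z1 where "z1 = z0 + unit_vec i"
  have adj: "adjacent z0 z1" by (auto simp: adjacent_iff z1_def)
  have z1: "W + norm1 p \<le> \<bar>idot p z1\<bar>" using adjacent_idot_le[OF adj, of p] z0 by linarith
  have "wave z0 (\<lambda>z. 2 * int CARD('n) - 1 + laplacian canon z) z
    = 2 * int CARD('n) - 1 + laplacian (\<lambda>z. canon z + H z) z"
  proof (rule wave_eq[OF _ adj])
    show "laplacian canon z0 = 0" using z0 W n1 by (intro laplacian_canonical_eq_0) linarith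
    show "laplacian canon z1 = 0" using z1 by (rule laplacian_canonical_eq_0)
    show "0 \<le> H z" for z by (rule H01)
    have "canon z0 = edge p z0" "canon (z0 - q) = edge p (z0 - q)"
      using z0 W n1 by (auto intro!: canonical_eq_edge)
    then show "H z0 = 1" using z0 W n1 by (simp add: H_def edge_def)
    show "superharmonic (\<lambda>z. canon z + H z)"
      unfolding sum superharmonic_def laplacian_add laplacian_shift laplacian_const
      using superharmonic_canonical by simp
    fix K
    assume K: "\<And>z. 0 \<le> K z \<and> K z \<le> H z" and Kz0: "K z0 = 1"
      and super: "superharmonic (\<lambda>z. canon z + K z)"
    have K1: "K z = 1" if "W + norm1 p < idot p z" for z
    proof -
      have "K z \<noteq> 0"
      proof (rule nonneg_superharmonic_on_halfspace[where p = "- p" and c = "- (W + norm1 p)" and ?z0.0 = z0])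
        show "laplacian K y \<le> 0" if "idot (- p) y < - (W + norm1 p)" for y
          using that by (intro laplacian_odometer_le_0[OF super]) simp
      qed (use K Kz0 z0 n1 that in auto)
      then show ?thesis using K[of z] H01[of z] by linarith
    qed
    \<comment> \<open>Subtracting 1 undoes the constant in \<open>H\<close>, so \<open>K = H\<close>
      again gives \<open>canon\<close>.\<close>
    define G where "G = (\<lambda>z. canon (z + q) + K (z + q) - 1)"
    have "G \<in> Theta (nat (W + 1)) (edge p)"
      unfolding Theta_edge_iff
    proof (intro conjI allI exI impI)
      show "superharmonic G"
        using super laplacian_shift[of "\<lambda>z. canon z + K z" q]
        by (simp add: superharmonic_def G_def laplacian_diff)
      show "G z \<le> edge p z" for z
        using K[of "z + q"] canonical_bounds(2)[of z] by (simp add: G_def H_def)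
      show "edge p z - int (nat (W + 1)) \<le> G z" for z
        using K[of "z + q"] canonical_bounds(1)[of "z + q"] edge_shift(1)[of z] W
        by (simp add: G_def)
      show "G z = edge p z" if "W + norm1 p + 1 < \<bar>idot p z\<bar>" for z
      proof -
        have eq: "canon z = edge p z" "canon (z + q) = edge p (z + q)"
          using that n1 by (auto intro!: canonical_eq_edge)
        show ?thesis
        proof (cases "0 \<le> idot p z")
          case True
          then have "K (z + q) = 1" using that by (intro K1) simp
          then show ?thesis using eq True by (simp add: G_def edge_def)
        next
          case False
          then have "H (z + q) = 0" using eq that W n1 by (simp add: H_def edge_def)
          then have "K (z + q) = 0" using K[of "z + q"] by linarith
          then show ?thesis using eq False that W n1 by (simp add: G_def edge_def)
        qed
      qed
    qed
    then have "canon (z - q) \<le> G (z - q)" for z by (rule canonical_husking_le)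
    then have "H z \<le> K z" for z by (simp add: G_def H_def algebra_simps)
    then show "K = H" using K by (intro ext antisym) auto
  qed
  moreover have "laplacian (\<lambda>z. canon (z + - q) + 1) z = laplacian canon (z - q)"
    by (simp only: laplacian_add laplacian_shift laplacian_const) simp
  ultimately show ?thesis unfolding sum by simp
qed

end

theorem proposition3p5:
  fixes p q :: "int ^ 'n"
    and \<Psi> \<psi> \<phi> :: "int ^ 'n \<Rightarrow> int"
  assumes "primitive p"
    and "\<Psi> = (\<lambda>z. min 0 (idot p z))"
    and "\<psi> = canonical_husking \<Psi>"
    and "idot p q = 1"
    and "\<phi> = (\<lambda>z. 2 * int CARD('n) - 1 + laplacian \<psi> z)"
  shows "\<exists>R>0. \<forall>z0. (\<forall>s\<in>defect \<psi>. R < edist z0 s) \<longrightarrow>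
           (\<forall>z. (\<psi> z0 < 0 \<longrightarrow>
                   wave z0 \<phi> z = 2 * int CARD('n) - 1 + laplacian \<psi> (z + q) \<and>
                   2 * int CARD('n) - 1 + laplacian \<psi> (z + q) = \<phi> (z + q)) \<and>
                (\<psi> z0 = 0 \<longrightarrow>
                   wave z0 \<phi> z = 2 * int CARD('n) - 1 + laplacian \<psi> (z - q) \<and>
                   2 * int CARD('n) - 1 + laplacian \<psi> (z - q) = \<phi> (z - q)))"
proof -
  interpret primitive_edge p q by unfold_locales (rule assms(4))
  have \<psi>: "\<psi> = canonical_husking (edge p)"
    using assms(2,3) by (simp add: edge_def[abs_def])
  \<comment> \<open>Beyond \<open>B\<close>, the point \<open>z0\<close> and its neighbours avoid
    the defect, and \<open>z0 + q\<close>, \<open>z0 - q\<close> lie where \<open>\<psi>\<close>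
    agrees with the edge.\<close>
  define B where "B = husk_width p q + 2 * norm1 p + 1"
  have B: "husk_width p q \<le> B" "0 \<le> B"
    using husk_width_nonneg[of p q] norm1_nonneg[of p] by (auto simp: B_def)
  obtain R where R: "0 < R"
    "\<And>z. \<forall>s\<in>defect \<psi>. R < edist z s \<Longrightarrow> B < \<bar>idot p z\<bar>"
    using far_from_defect[OF B(2)] unfolding \<psi> by blast
  have "(\<psi> z0 < 0 \<longrightarrow> wave z0 \<phi> z = 2 * int CARD('n) - 1 + laplacian \<psi> (z + q)) \<and>
      (\<psi> z0 = 0 \<longrightarrow> wave z0 \<phi> z = 2 * int CARD('n) - 1 + laplacian \<psi> (z - q))"
    if "\<forall>s\<in>defect \<psi>. R < edist z0 s" for z0 z
  proof -
    have far: "B < \<bar>idot p z0\<bar>" by (rule R(2)[OF that])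
    have "\<psi> z0 = min 0 (idot p z0)"
      using canonical_eq_edge[of z0] far B unfolding \<psi> edge_def by simp
    then show ?thesis
      using far B wave_negative_side[of z0 z] wave_zero_side[of z0 z]
      unfolding assms(5) \<psi> B_def by (auto simp: min_def split: if_splits)
  qed
  then show ?thesis
    using R(1) assms(5) by (intro exI[of _ R]) simp
qed

end
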